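(* There exists a sequence $(c_k)_{k\ge 2}$ of positive real numbers such that for any integer $k\ge 2$, almost surely, $$c_k<\liminf_{n\to\infty}\frac{X_n^{\ge k+1}}{X_n^{\ge k}}\le 1 .$$
   Context: The random friend tree process $(T_n)_{n\ge 2}$ is defined as follows. $T_2$ is a single edge joining vertices labelled $1$ and $2$. For $n\ge 2$, given $T_n$ (and the past of the process), $V_n$ is chosen uniformly at random in $\{1,\dots,n\}$, and then $W_n$ is a uniformly random neighbour of $V_n$ in $T_n$; $T_{n+1}$ is obtained from $T_n$ by adding a new vertex labelled $n+1$ joined by an edge to $W_n$. Thus $T_n$ is a tree with vertex set $[n]=\{1,\dots,n\}$. $X_n^{\ge k}$ denotes the number of vertices of $T_n$ whose degree in $T_n$ is at least $k$. The ratio is considered only for those $n$ with $X_n^{\ge k}>0$. *)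

theory Defs
  imports "HOL-Probability.Probability"
begin

text \<open>A simple graph on a known vertex set is represented by its set of edges, each edge being
  a two-element set of vertices.\<close>

definition neighbours :: "'v set set \<Rightarrow> 'v \<Rightarrow> 'v set" where
  "neighbours E v = {w. {v, w} \<in> E}"

definition deg :: "'v set set \<Rightarrow> 'v \<Rightarrow> nat" where
  "deg E v = card (neighbours E v)"

definition num_deg_ge :: "nat \<Rightarrow> nat set set \<Rightarrow> nat \<Rightarrow> nat" where
  "num_deg_ge n E k = card {v \<in> {1..n}. k \<le> deg E v}"

text \<open>\<open>T n\<close> is the edge set of the tree, whose vertex set is \<open>{1..n}\<close>; \<open>V n\<close> and \<open>W n\<close> are the
  uniform vertex and its uniform neighbour. The past at time \<open>n\<close> is the event that
  \<open>T 2, ..., T n\<close> equal prescribed graphs. Conditional probabilities are only prescribed given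
  events of positive probability (in the library, conditioning on a null event yields 0).
  Conditioning also on \<open>V i\<close> for \<open>i < n\<close> would be a stronger assumption (the \<open>W i\<close> for
  \<open>i < n\<close> are almost surely determined by the trees); it yields the same law of \<open>T\<close>.\<close>

locale random_friend_tree = prob_space M
  for M :: "'a measure" +
  fixes T :: "nat \<Rightarrow> 'a \<Rightarrow> nat set set"
    and V W :: "nat \<Rightarrow> 'a \<Rightarrow> nat"
  assumes V_measurable: "\<And>n. 2 \<le> n \<Longrightarrow> V n \<in> measurable M (count_space UNIV)"
    and W_measurable: "\<And>n. 2 \<le> n \<Longrightarrow> W n \<in> measurable M (count_space UNIV)"
    and T_2: "\<And>\<omega>. \<omega> \<in> space M \<Longrightarrow> T 2 \<omega> = {{1, 2}}"
    and T_Suc: "\<And>n \<omega>. 2 \<le> n \<Longrightarrow> \<omega> \<in> space M \<Longrightarrow>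
      T (Suc n) \<omega> = insert {Suc n, W n \<omega>} (T n \<omega>)"
    and V_uniform: "\<And>n t v. 2 \<le> n \<Longrightarrow> v \<in> {1..n} \<Longrightarrow>
      0 < \<P>(\<omega> in M. \<forall>i\<in>{2..n}. T i \<omega> = t i) \<Longrightarrow>
      \<P>(\<omega> in M. V n \<omega> = v \<bar> \<forall>i\<in>{2..n}. T i \<omega> = t i) = 1 / real n"
    and W_uniform: "\<And>n t v w. 2 \<le> n \<Longrightarrow> v \<in> {1..n} \<Longrightarrow> w \<in> neighbours (t n) v \<Longrightarrow>
      0 < \<P>(\<omega> in M. (\<forall>i\<in>{2..n}. T i \<omega> = t i) \<and> V n \<omega> = v) \<Longrightarrow>
      \<P>(\<omega> in M. W n \<omega> = w \<bar> (\<forall>i\<in>{2..n}. T i \<omega> = t i) \<and> V n \<omega> = v)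
        = 1 / real (deg (t n) v)"

end

theory Submission
  imports Defs
begin

text \<open>
  Write \<open>N k\<close> for the number of vertices of degree at least \<open>k\<close>, as a function of the time \<open>n\<close>. The
  upper bound holds because \<open>N (k + 1) \<le> N k\<close> and \<open>N k\<close> is eventually positive. For the lower
  bound, one compares the conditional probabilities with which \<open>N k\<close> and \<open>N (k + 1)\<close> grow.

  A vertex of degree exactly \<open>k\<close> with a leaf neighbour is called good here; it receives the next
  vertex with probability at least \<open>1 / n\<close>, since choosing the leaf forces this. Hence \<open>N (k + 1)\<close>
  grows with probability at least \<open>G / n\<close>, where \<open>G\<close> is the number of good vertices
  (\<open>step_prob_deg_ge_good\<close>). A vertex of degree \<open>k \<ge> 2\<close> is good when it reaches that degree, because its newest
  neighbour is a leaf, and it becomes bad only if its last leaf neighbour is chosen for attachment,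
  which happens to some vertex with probability at most \<open>G / n\<close> (\<open>card_bad_attach\<close>,
  \<open>step_prob_spoils_le_good\<close>). So the number of bad vertices is at most of the order of \<open>N (k + 1)\<close>, and
  \<open>G \<ge> N k - 5 N (k + 1) - K\<close> for a random constant \<open>K\<close>.

  On the other hand \<open>N k\<close> eventually grows with probability at most \<open>C N k / n\<close>. For \<open>k = 2\<close> this holds with
  \<open>C = 1\<close>, by grouping leaves according to their neighbour (\<open>step_prob_leaf_le\<close>); for larger \<open>k\<close> the
  probability is at most \<open>(k - 1) N (k - 1) / n\<close>, and by induction \<open>N (k - 1)\<close> is at most a constant
  multiple of \<open>N k\<close>. With \<open>log n\<close> as time, the ratio \<open>r = N (k + 1) / N k\<close> therefore behaves like a
  solution of \<open>r' \<ge> 1 - (5 + C) r\<close>, which keeps it away from \<open>0\<close> (\<open>growth_comparison\<close>).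

  To pass from conditional probabilities to actual counts, every counting process is compared with
  its compensator, the sum of the conditional probabilities: almost surely each is at most twice
  the other plus a random constant (\<open>count_comparable_to_compensator\<close>). This follows from an
  exponential supermartingale and the maximal inequality. It also shows that \<open>N 2\<close> tends to
  infinity, since it grows with probability at least \<open>1 / (2 n)\<close> (\<open>step_prob_leaf_ge\<close>); the ratio
  bounds carry this over to all \<open>N k\<close>.
\<close>

section \<open>Comparison of growth rates\<close>

lemma eventually_const_le:
  fixes x :: "nat \<Rightarrow> real"
  assumes "filterlim x at_top sequentially"
  shows "eventually (\<lambda>n. C \<le> x n) sequentially"
  using assms by (simp add: filterlim_at_top)

text \<open>Once \<open>a \<le> n\<close>, the factor \<open>1 - a / n\<close> lies in \<open>[0, 1]\<close>, so a negative value can only be pulled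
  towards \<open>0\<close>.\<close>

lemma contracting_recursion_bounded_below:
  fixes Z :: "nat \<Rightarrow> real" and a :: real
  assumes "eventually (\<lambda>n. Z n - a * Z n / n \<le> Z (Suc n)) sequentially" "0 \<le> a"
  shows "\<exists>K. eventually (\<lambda>n. - K \<le> Z n) sequentially"
proof -
  have "eventually (\<lambda>n. a \<le> real n) sequentially" by real_asymp
  with assms(1) have "eventually (\<lambda>n. Z n - a * Z n / n \<le> Z (Suc n) \<and> a \<le> real n) sequentially"
    by eventually_elim simp
  then obtain m0 where "\<And>n. m0 \<le> n \<Longrightarrow> Z n - a * Z n / n \<le> Z (Suc n) \<and> a \<le> real n"
    unfolding eventually_sequentially by blast
  then obtain m where m: "\<And>n. m \<le> n \<Longrightarrow> Z n - a * Z n / n \<le> Z (Suc n)" "\<And>n. m \<le> n \<Longrightarrow> a \<le> real n" "1 \<le> m"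
    by (metis max.bounded_iff max.cobounded2)
  have "- \<bar>Z m\<bar> \<le> Z n" if "m \<le> n" for n
    using that
  proof (induction rule: dec_induct)
    case (step n)
    have n: "0 < real n" using step m(3) by simp
    have "- \<bar>Z m\<bar> \<le> (1 - a / n) * (- \<bar>Z m\<bar>)"
      using assms(2) n by (simp add: algebra_simps)
    also have "\<dots> \<le> (1 - a / n) * Z n"
      using step m(2)[of n] n by (intro mult_left_mono) auto
    also have "\<dots> \<le> Z (Suc n)" using m(1)[of n] step by (simp add: algebra_simps)
    finally show ?case .
  qed simp
  then show ?thesis unfolding eventually_sequentially by blast
qed

text \<open>The analytic core. Read \<open>log n\<close> as time: then \<open>x' \<le> C x\<close> and \<open>y' \<ge> G \<ge> x - 5 y\<close>, up to constants, so that
  the ratio \<open>r = y / x\<close> satisfies \<open>r' \<ge> 1 - (5 + C) r\<close> and cannot stay small. Only the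
  compensators \<open>X\<close> and \<open>Y\<close> obey such differential inequalities; the processes \<open>x\<close> and \<open>y\<close> are
  comparable to them up to a factor \<open>2\<close> and an additive constant. The proof considers
  \<open>Z = Y - c X\<close>, which is eventually subject to the contracting recursion with \<open>a = 10\<close>; hence
  \<open>Y \<ge> c X - K'\<close>, and the constants are absorbed because \<open>x\<close> tends to infinity.\<close>

lemma growth_comparison:
  fixes x y X Y G :: "nat \<Rightarrow> real" and C c :: real
  assumes x: "filterlim x at_top sequentially"
    and x_nonneg: "\<And>n. 0 \<le> x n"
    and K: "\<And>n. 2 \<le> n \<Longrightarrow> X n \<le> 2 * x n + K \<and> y n \<le> 2 * Y n + K \<and> Y n \<le> 2 * y n + K
          \<and> x n \<le> 2 * X n + K"
    and G: "\<And>n. 2 \<le> n \<Longrightarrow> x n \<le> G n + 5 * y n + K"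
    and Y: "\<And>n. 2 \<le> n \<Longrightarrow> Y n + G n / n \<le> Y (Suc n)"
    and X: "eventually (\<lambda>n. X (Suc n) \<le> X n + C * x n / n) sequentially"
    and c: "0 < c" "c * (20 + C) \<le> 1 / 2"
  shows "eventually (\<lambda>n. c / 8 * x n \<le> y n) sequentially"
proof -
  define Z where "Z n = Y n - c * X n" for n
  have "eventually (\<lambda>n. Z n - 10 * Z n / n \<le> Z (Suc n)) sequentially"
    \<comment> \<open>The bound on \<open>x n\<close> makes half of \<open>x n\<close> pay for all additive constants in \<open>G'\<close> below.\<close>
    using X eventually_const_le[OF x, of "2 * (6 * K + 10 * c * K)"] eventually_ge_at_top[of 2]
  proof eventually_elim
    case (elim n)
    have n: "0 < real n" using elim by simp
    have "y n \<le> 2 * Z n + 2 * (c * X n) + K" using K[OF elim(3)] by (simp add: Z_def)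
    moreover have "c * X n \<le> c * (2 * x n + K)" using K[OF elim(3)] c by simp
    ultimately have "5 * y n \<le> 10 * Z n + 10 * (2 * (c * x n) + c * K) + 5 * K"
      by (simp add: algebra_simps)
    with G[OF elim(3)] have G': "x n - 10 * Z n - 20 * (c * x n) - 10 * (c * K) - 6 * K \<le> G n"
      by simp
    have x0: "0 \<le> x n" using x_nonneg .
    have "(c * (20 + C)) * x n \<le> 1 / 2 * x n"
      using c x0 by (intro mult_right_mono) auto
    then have "20 * (c * x n) + c * C * x n \<le> x n / 2" by (simp add: algebra_simps)
    moreover have "0 \<le> c * x n" using c x0 by simp
    ultimately have "- 10 * Z n \<le> G n - c * C * x n"
      using G' elim(2) by (simp add: algebra_simps)
    then have "- 10 * Z n / n \<le> (G n - c * C * x n) / n"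
      using n by (intro divide_right_mono) auto
    also have "\<dots> = G n / n - c * (C * x n / n)" by (simp add: diff_divide_distrib)
    also have "\<dots> \<le> Z (Suc n) - Z n"
      using Y[OF elim(3)] mult_left_mono[OF elim(1), of c] c(1) by (simp add: Z_def algebra_simps)
    finally show ?case by simp
  qed
  then obtain K' where K': "eventually (\<lambda>n. - K' \<le> Z n) sequentially"
    using contracting_recursion_bounded_below[of Z 10] by auto
  show ?thesis
    using K' eventually_const_le[OF x, of "4 * (K + K' + c * K / 2) / c"] eventually_ge_at_top[of 2]
  proof eventually_elim
    case (elim n)
    have "4 * (K + K' + c * K / 2) \<le> c * x n"
      using elim(2) c(1) by (simp add: field_simps)
    moreover have "c * x n \<le> c * (2 * X n + K)" using K[OF elim(3)] c by simp
    ultimately show ?case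
      using elim(1) K[OF elim(3)] by (simp add: Z_def algebra_simps)
  qed
qed

section \<open>Counting processes and their compensators\<close>

text \<open>Filtrations are represented by a history process \<open>H\<close> with countably many values: a process is
  adapted if it is a function of the history, and the conditional inequality is stated on the
  atoms \<open>{H n = g}\<close>. Summing over these atoms gives the inequality of expectations.\<close>

lemma (in prob_space) supermartingale_expectation_le:
  fixes H :: "nat \<Rightarrow> 'a \<Rightarrow> 'h::countable" and Z :: "nat \<Rightarrow> 'h \<Rightarrow> ennreal"
  assumes H [measurable]: "\<And>n. H n \<in> measurable M (count_space UNIV)"
    and step: "\<And>n g. (\<integral>\<^sup>+\<omega>. Z (Suc n) (H (Suc n) \<omega>) * indicator {\<omega>\<in>space M. H n \<omega> = g} \<omega> \<partial>M)
        \<le> Z n g * emeasure M {\<omega>\<in>space M. H n \<omega> = g}"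
  shows "(\<integral>\<^sup>+\<omega>. Z n (H n \<omega>) \<partial>M) \<le> (\<integral>\<^sup>+\<omega>. Z 0 (H 0 \<omega>) \<partial>M)"
proof (induction n)
  case (Suc n)
  define E where "E m = {\<omega>\<in>space M. to_nat (H n \<omega>) = m}" for m
  have E [measurable]: "E m \<in> sets M" for m
    unfolding E_def by measurable
  have split: "(\<integral>\<^sup>+\<omega>. f \<omega> \<partial>M) = (\<Sum>m. \<integral>\<^sup>+\<omega>. f \<omega> * indicator (E m) \<omega> \<partial>M)"
    if [measurable]: "f \<in> borel_measurable M" for f :: "'a \<Rightarrow> ennreal"
  proof -
    have "(\<integral>\<^sup>+\<omega>. f \<omega> \<partial>M) = (\<integral>\<^sup>+\<omega>. (\<Sum>m. f \<omega> * indicator (E m) \<omega>) \<partial>M)"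
    proof (rule nn_integral_cong)
      fix \<omega> assume "\<omega> \<in> space M"
      then have "(\<lambda>m. f \<omega> * indicator (E m) \<omega>) = (\<lambda>m. if m = to_nat (H n \<omega>) then f \<omega> else 0)"
        by (auto simp: E_def indicator_def)
      then show "f \<omega> = (\<Sum>m. f \<omega> * indicator (E m) \<omega>)"
        using sums_single[of "to_nat (H n \<omega>)" "\<lambda>_. f \<omega>"] by (simp add: sums_iff)
    qed
    also have "\<dots> = (\<Sum>m. \<integral>\<^sup>+\<omega>. f \<omega> * indicator (E m) \<omega> \<partial>M)"
      by (rule nn_integral_suminf) measurable
    finally show ?thesis .
  qed
  have "(\<integral>\<^sup>+\<omega>. Z (Suc n) (H (Suc n) \<omega>) * indicator (E m) \<omega> \<partial>M)
      \<le> (\<integral>\<^sup>+\<omega>. Z n (H n \<omega>) * indicator (E m) \<omega> \<partial>M)" for m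
  proof (cases "\<exists>g. m = to_nat (g :: 'h)")
    case True
    then obtain g :: 'h where g: "m = to_nat g" by blast
    have Eg: "E m = {\<omega>\<in>space M. H n \<omega> = g}" by (auto simp: E_def g)
    have "(\<integral>\<^sup>+\<omega>. Z n (H n \<omega>) * indicator (E m) \<omega> \<partial>M) = (\<integral>\<^sup>+\<omega>. Z n g * indicator (E m) \<omega> \<partial>M)"
      by (rule nn_integral_cong) (auto simp: Eg indicator_def)
    also have "\<dots> = Z n g * emeasure M (E m)"
      by (rule nn_integral_cmult_indicator) measurable
    finally show ?thesis using step[of n g] by (simp add: Eg)
  next
    case False
    then have "E m = {}" by (auto simp: E_def)
    then show ?thesis by simp
  qed
  then have "(\<integral>\<^sup>+\<omega>. Z (Suc n) (H (Suc n) \<omega>) \<partial>M) \<le> (\<integral>\<^sup>+\<omega>. Z n (H n \<omega>) \<partial>M)"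
    by (subst (1 2) split) (auto intro!: suminf_le)
  with Suc show ?case by simp
qed simp

text \<open>The maximal inequality for nonnegative supermartingales. The process \<open>S\<close> is \<open>Z\<close> frozen when it
  first reaches the level \<open>K\<close>; it is again a supermartingale, so Markov's inequality bounds the
  probability of \<open>K \<le> S n\<close> for each \<open>n\<close>. These events increase with \<open>n\<close>, since \<open>S\<close> never leaves
  \<open>[K, \<infinity>]\<close>, and their union is the event that \<open>Z\<close> ever reaches \<open>K\<close>. That earlier histories are
  functions of later ones is what makes \<open>S\<close> adapted.\<close>

lemma (in prob_space) Ville_inequality:
  fixes H :: "nat \<Rightarrow> 'a \<Rightarrow> 'h::countable" and Z :: "nat \<Rightarrow> 'h \<Rightarrow> ennreal"
  assumes H [measurable]: "\<And>n. H n \<in> measurable M (count_space UNIV)"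
    and past: "\<And>n \<omega>. \<omega> \<in> space M \<Longrightarrow> H n \<omega> = past (H (Suc n) \<omega>)"
    and step: "\<And>n g. (\<integral>\<^sup>+\<omega>. Z (Suc n) (H (Suc n) \<omega>) * indicator {\<omega>\<in>space M. H n \<omega> = g} \<omega> \<partial>M)
        \<le> Z n g * emeasure M {\<omega>\<in>space M. H n \<omega> = g}"
  shows "K * emeasure M {\<omega>\<in>space M. \<exists>n. K \<le> Z n (H n \<omega>)} \<le> (\<integral>\<^sup>+\<omega>. Z 0 (H 0 \<omega>) \<partial>M)"
proof -
  define S where
    "S = rec_nat (Z 0) (\<lambda>n s g. if K \<le> s (past g) then s (past g) else Z (Suc n) g)"
  have S_0: "S 0 = Z 0"
    and S_Suc: "\<And>n g. S (Suc n) g = (if K \<le> S n (past g) then S n (past g) else Z (Suc n) g)"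
    by (simp_all add: S_def)
  have S_Z: "S n g = Z n g \<or> K \<le> S n g" for n g
    by (cases n) (auto simp: S_0 S_Suc)
  have stopped: "(\<integral>\<^sup>+\<omega>. S n (H n \<omega>) \<partial>M) \<le> (\<integral>\<^sup>+\<omega>. Z 0 (H 0 \<omega>) \<partial>M)" for n
    unfolding S_0[symmetric]
  proof (rule supermartingale_expectation_le[OF H])
    fix n g
    show "(\<integral>\<^sup>+\<omega>. S (Suc n) (H (Suc n) \<omega>) * indicator {\<omega>\<in>space M. H n \<omega> = g} \<omega> \<partial>M)
        \<le> S n g * emeasure M {\<omega>\<in>space M. H n \<omega> = g}"
    proof (cases "K \<le> S n g")
      case True
      then have "(\<integral>\<^sup>+\<omega>. S (Suc n) (H (Suc n) \<omega>) * indicator {\<omega>\<in>space M. H n \<omega> = g} \<omega> \<partial>M)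
          = (\<integral>\<^sup>+\<omega>. S n g * indicator {\<omega>\<in>space M. H n \<omega> = g} \<omega> \<partial>M)"
        by (intro nn_integral_cong) (auto simp: S_Suc indicator_def past[symmetric])
      also have "\<dots> = S n g * emeasure M {\<omega>\<in>space M. H n \<omega> = g}"
        by (rule nn_integral_cmult_indicator) measurable
      finally show ?thesis by simp
    next
      case False
      then have "(\<integral>\<^sup>+\<omega>. S (Suc n) (H (Suc n) \<omega>) * indicator {\<omega>\<in>space M. H n \<omega> = g} \<omega> \<partial>M)
          = (\<integral>\<^sup>+\<omega>. Z (Suc n) (H (Suc n) \<omega>) * indicator {\<omega>\<in>space M. H n \<omega> = g} \<omega> \<partial>M)"
        by (intro nn_integral_cong) (auto simp: S_Suc indicator_def past[symmetric])
      with step[of n g] S_Z[of n g] False show ?thesis by auto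
    qed
  qed
  define B where "B n = {\<omega>\<in>space M. K \<le> S n (H n \<omega>)}" for n
  have B [measurable]: "B n \<in> sets M" for n unfolding B_def by measurable
  have "K * emeasure M (B n) \<le> (\<integral>\<^sup>+\<omega>. Z 0 (H 0 \<omega>) \<partial>M)" for n
  proof -
    have "K * emeasure M (B n) = (\<integral>\<^sup>+\<omega>. K * indicator (B n) \<omega> \<partial>M)"
      by (rule nn_integral_cmult_indicator[symmetric]) measurable
    also have "\<dots> \<le> (\<integral>\<^sup>+\<omega>. S n (H n \<omega>) \<partial>M)"
      by (rule nn_integral_mono) (auto simp: B_def indicator_def)
    finally show ?thesis using stopped[of n] by simp
  qed
  moreover have "incseq B"
    by (rule incseq_SucI) (auto simp: B_def S_Suc past[symmetric])
  then have "emeasure M (\<Union>n. B n) = (SUP n. emeasure M (B n))"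
    by (intro SUP_emeasure_incseq[symmetric]) auto
  ultimately have "K * emeasure M (\<Union>n. B n) \<le> (\<integral>\<^sup>+\<omega>. Z 0 (H 0 \<omega>) \<partial>M)"
    by (auto simp: SUP_mult_left_ennreal intro!: SUP_least)
  moreover have "{\<omega>\<in>space M. \<exists>n. K \<le> Z n (H n \<omega>)} = (\<Union>n. B n)"
  proof -
    have "\<exists>n. K \<le> Z n (H n \<omega>)" if "\<omega> \<in> space M" "K \<le> S n (H n \<omega>)" for n \<omega>
      using that(2)
    proof (induction n)
      case 0 then show ?case by (auto simp: S_0)
    next
      case (Suc n) then show ?case
        by (auto simp: S_Suc past[OF that(1), symmetric] split: if_splits)
    qed
    moreover have "\<exists>n. K \<le> S n (H n \<omega>)" if "K \<le> Z n (H n \<omega>)" for n \<omega>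
      using S_Z[of n "H n \<omega>"] that by (intro exI[of _ n]) auto
    ultimately show ?thesis by (auto simp: B_def)
  qed
  ultimately show ?thesis by simp
qed

text \<open>If an event has conditional probability \<open>p\<close>, then \<open>E exp (r 1\<^sub>A) = 1 + (exp r - 1) p \<le> exp ((exp r - 1) p)\<close>
  conditionally. Hence the exponential of \<open>D\<close>, which is \<open>r\<close> times the number of events minus
  \<open>exp r - 1\<close> times its compensator, is a supermartingale started at \<open>1\<close>, and the maximal
  inequality shows that \<open>D\<close> is almost surely bounded above.\<close>

lemma (in prob_space) exponential_compensator_bound:
  fixes H :: "nat \<Rightarrow> 'a \<Rightarrow> 'h::countable" and A :: "'h \<Rightarrow> bool" and p :: "nat \<Rightarrow> 'h \<Rightarrow> real"
    and r :: real
  assumes H [measurable]: "\<And>n. H n \<in> measurable M (count_space UNIV)"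
    and past: "\<And>n \<omega>. \<omega> \<in> space M \<Longrightarrow> H n \<omega> = past (H (Suc n) \<omega>)"
    and p: "\<And>n g. prob {\<omega>\<in>space M. H n \<omega> = g \<and> A (H (Suc n) \<omega>)}
        = p n g * prob {\<omega>\<in>space M. H n \<omega> = g}"
  shows "AE \<omega> in M. \<exists>K. \<forall>n. r * (\<Sum>i<n. of_bool (A (H (Suc i) \<omega>)))
      \<le> (exp r - 1) * (\<Sum>i<n. p i (H i \<omega>)) + K"
proof -
  define D where "D = rec_nat (\<lambda>_. 0)
    (\<lambda>n d g. d (past g) + r * of_bool (A g) - (exp r - 1) * p n (past g))"
  have D_0: "D 0 g = 0" and D_Suc:
    "D (Suc n) g = D n (past g) + r * of_bool (A g) - (exp r - 1) * p n (past g)" for n g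
    by (simp_all add: D_def)
  have D_eq: "D n (H n \<omega>) = r * (\<Sum>i<n. of_bool (A (H (Suc i) \<omega>)))
      - (exp r - 1) * (\<Sum>i<n. p i (H i \<omega>))" if "\<omega> \<in> space M" for n \<omega>
    by (induction n) (auto simp: D_0 D_Suc past[OF that, symmetric] algebra_simps)
  have step: "(\<integral>\<^sup>+\<omega>. ennreal (exp (D (Suc n) (H (Suc n) \<omega>)))
        * indicator {\<omega>\<in>space M. H n \<omega> = g} \<omega> \<partial>M)
      \<le> ennreal (exp (D n g)) * emeasure M {\<omega>\<in>space M. H n \<omega> = g}" for n g
  proof -
    define F where "F = {\<omega>\<in>space M. H n \<omega> = g}"
    define FA where "FA = {\<omega>\<in>space M. H n \<omega> = g \<and> A (H (Suc n) \<omega>)}"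
    define FN where "FN = {\<omega>\<in>space M. H n \<omega> = g \<and> \<not> A (H (Suc n) \<omega>)}"
    have [measurable]: "F \<in> sets M" "FA \<in> sets M" "FN \<in> sets M"
      unfolding F_def FA_def FN_def by measurable
    define e where "e = exp (D n g - (exp r - 1) * p n g)"
    have "F = FA \<union> FN" "FA \<inter> FN = {}" by (auto simp: F_def FA_def FN_def)
    then have PF: "prob F = prob FA + prob FN" by (simp add: finite_measure_Union)
    have PA: "prob FA = p n g * prob F" using p[of n g] by (simp add: F_def FA_def)
    have "(\<integral>\<^sup>+\<omega>. ennreal (exp (D (Suc n) (H (Suc n) \<omega>))) * indicator F \<omega> \<partial>M)
        = (\<integral>\<^sup>+\<omega>. ennreal (e * exp r) * indicator FA \<omega> + ennreal e * indicator FN \<omega> \<partial>M)"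
      by (intro nn_integral_cong)
        (auto simp: F_def FA_def FN_def e_def indicator_def D_Suc past[symmetric] exp_add[symmetric]
          algebra_simps)
    also have "\<dots> = ennreal (e * exp r) * emeasure M FA + ennreal e * emeasure M FN"
      by (subst nn_integral_add) (auto simp: nn_integral_cmult_indicator)
    also have "\<dots> = ennreal (e * exp r * prob FA + e * prob FN)"
      by (simp add: emeasure_eq_measure e_def ennreal_mult[symmetric] ennreal_plus[symmetric] del: ennreal_plus)
    also have "e * exp r * prob FA + e * prob FN = e * (1 + (exp r - 1) * p n g) * prob F"
      using PF PA by algebra
    also have "\<dots> \<le> e * exp ((exp r - 1) * p n g) * prob F"
      by (intro mult_right_mono mult_left_mono exp_ge_add_one_self) (auto simp: e_def)
    also have "\<dots> = exp (D n g) * prob F"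
      by (simp add: e_def exp_add[symmetric])
    finally show ?thesis
      unfolding F_def[symmetric]
      by (simp add: emeasure_eq_measure ennreal_mult[symmetric] ennreal_leI)
  qed
  define B where "B j = {\<omega>\<in>space M. \<exists>n. ennreal (exp (real j)) \<le> ennreal (exp (D n (H n \<omega>)))}" for j
  have B [measurable]: "B j \<in> sets M" for j unfolding B_def by measurable
  have PB: "prob (B j) \<le> exp (- real j)" for j
  proof -
    have "ennreal (exp (real j)) * emeasure M (B j) \<le> (\<integral>\<^sup>+\<omega>. ennreal (exp (D 0 (H 0 \<omega>))) \<partial>M)"
      unfolding B_def
      by (rule Ville_inequality[where past = past and Z = "\<lambda>n g. ennreal (exp (D n g))",
            OF H past step])
    also have "\<dots> = 1" by (simp add: D_0 emeasure_space_1)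
    finally have "exp (real j) * prob (B j) \<le> 1"
      by (simp add: emeasure_eq_measure ennreal_mult[symmetric] flip: ennreal_1)
    then show ?thesis by (simp add: exp_minus field_simps)
  qed
  have "prob (\<Inter>j. B j) \<le> exp (- real j)" for j
    using PB[of j] finite_measure_mono[of "\<Inter>j. B j" "B j"] by force
  moreover have "(\<lambda>j. exp (- real j)) \<longlonglongrightarrow> 0" by real_asymp
  ultimately have "prob (\<Inter>j. B j) \<le> 0"
    by (intro LIMSEQ_le_const) auto
  then have "emeasure M (\<Inter>j. B j) = 0"
    by (simp add: emeasure_eq_measure measure_le_0_iff)
  then have "AE \<omega> in M. \<omega> \<notin> (\<Inter>j. B j)"
    by (intro AE_not_in) (auto simp: null_sets_def)
  then show ?thesis
  proof (rule AE_mp, intro AE_I2 impI)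
    fix \<omega> assume \<omega>: "\<omega> \<in> space M" "\<omega> \<notin> (\<Inter>j. B j)"
    then obtain j where "\<forall>n. D n (H n \<omega>) < real j"
      by (auto simp: B_def not_le)
    then show "\<exists>K. \<forall>n. r * (\<Sum>i<n. of_bool (A (H (Suc i) \<omega>)))
      \<le> (exp r - 1) * (\<Sum>i<n. p i (H i \<omega>)) + K"
      using D_eq[OF \<omega>(1)] by (intro exI[of _ "real j"]) (smt (verit))
  qed
qed

text \<open>A quantitative form of Levy's extension of the Borel-Cantelli lemmas, obtained from the
  exponential bounds with \<open>r = 1\<close> and \<open>r = -1\<close>: the constants \<open>exp 1 - 1 \<le> 2\<close> and
  \<open>1 - exp (-1) \<ge> 1 / 2\<close> give the factors \<open>2\<close>. Working with bounds up to a random additive constant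
  avoids any convergence theorem for martingales.\<close>

lemma (in prob_space) count_comparable_to_compensator:
  fixes H :: "nat \<Rightarrow> 'a \<Rightarrow> 'h::countable" and A :: "'h \<Rightarrow> bool" and p :: "nat \<Rightarrow> 'h \<Rightarrow> real"
  assumes H [measurable]: "\<And>n. H n \<in> measurable M (count_space UNIV)"
    and past: "\<And>n \<omega>. \<omega> \<in> space M \<Longrightarrow> H n \<omega> = past (H (Suc n) \<omega>)"
    and p: "\<And>n g. prob {\<omega>\<in>space M. H n \<omega> = g \<and> A (H (Suc n) \<omega>)}
        = p n g * prob {\<omega>\<in>space M. H n \<omega> = g}"
    and nonneg: "\<And>n g. 0 \<le> p n g"
  shows "AE \<omega> in M. \<exists>K. \<forall>n.
      (\<Sum>i<n. of_bool (A (H (Suc i) \<omega>))) \<le> 2 * (\<Sum>i<n. p i (H i \<omega>)) + K \<and>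
      (\<Sum>i<n. p i (H i \<omega>)) \<le> 2 * (\<Sum>i<n. of_bool (A (H (Suc i) \<omega>))) + K"
proof -
  have bound: "AE \<omega> in M. \<exists>K. \<forall>n. r * (\<Sum>i<n. of_bool (A (H (Suc i) \<omega>)))
      \<le> (exp r - 1) * (\<Sum>i<n. p i (H i \<omega>)) + K" for r
    by (rule exponential_compensator_bound[of H past A p r, OF H past p])
  show ?thesis
    using bound[of 1] bound[of "-1"]
  proof eventually_elim
    case (elim \<omega>)
    then obtain K1 K2 where
      K1: "\<And>n. (\<Sum>i<n. of_bool (A (H (Suc i) \<omega>))) \<le> (exp 1 - 1) * (\<Sum>i<n. p i (H i \<omega>)) + K1"
      and K2: "\<And>n. - (\<Sum>i<n. of_bool (A (H (Suc i) \<omega>))) \<le> (exp (- 1) - 1) * (\<Sum>i<n. p i (H i \<omega>)) + K2"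
      by auto
    have e: "exp 1 \<le> (3::real)" "exp (- 1) \<le> (1/2::real)"
      using exp_le exp_ge_add_one_self[of "1::real"] by (auto simp: exp_minus field_simps)
    have S: "0 \<le> (\<Sum>i<n. p i (H i \<omega>))" for n by (intro sum_nonneg nonneg)
    have bounds: "(exp 1 - 1) * (\<Sum>i<n. p i (H i \<omega>)) \<le> 2 * (\<Sum>i<n. p i (H i \<omega>))"
      and bounds2: "(exp (- 1) - 1) * (\<Sum>i<n. p i (H i \<omega>)) \<le> (- 1/2) * (\<Sum>i<n. p i (H i \<omega>))" for n
      using S[of n] e by (intro mult_right_mono; simp)+
    have up: "(\<Sum>i<n. of_bool (A (H (Suc i) \<omega>))) \<le> 2 * (\<Sum>i<n. p i (H i \<omega>)) + K1" for n
      using K1[of n] bounds[of n] by linarith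
    have "- (\<Sum>i<n. of_bool (A (H (Suc i) \<omega>))) \<le> (- 1/2) * (\<Sum>i<n. p i (H i \<omega>)) + K2" for n
      using order_trans[OF K2[of n] add_right_mono[OF bounds2[of n]]] .
    then have down: "(\<Sum>i<n. p i (H i \<omega>)) \<le> 2 * (\<Sum>i<n. of_bool (A (H (Suc i) \<omega>))) + 2 * K2" for n
      by (simp add: field_simps)
    from up down show ?case
      by (intro exI[of _ "max K1 (2 * K2)"] allI conjI) (meson add_left_mono max.cobounded1 max.cobounded2 order_trans)+
  qed
qed

section \<open>One step of the tree\<close>

inductive friend_tree :: "nat \<Rightarrow> nat set set \<Rightarrow> bool" where
  edge: "friend_tree 2 {{1, 2}}"
| attach: "friend_tree n E \<Longrightarrow> w \<in> {1..n} \<Longrightarrow> friend_tree (Suc n) (insert {Suc n, w} E)"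

lemma friend_tree_ge_2: "friend_tree n E \<Longrightarrow> 2 \<le> n"
  by (induction rule: friend_tree.induct) auto

lemma neighbours_sym: "v \<in> neighbours E w \<longleftrightarrow> w \<in> neighbours E v"
  by (simp add: neighbours_def insert_commute)

lemma edge_subset: "friend_tree n E \<Longrightarrow> e \<in> E \<Longrightarrow> e \<subseteq> {1..n}"
proof (induction arbitrary: e rule: friend_tree.induct)
  case (attach n E w)
  have "e = {Suc n, w} \<or> e \<subseteq> {1..n}" using attach.IH[of e] attach.prems by auto
  moreover have "{1..n} \<subseteq> {1..Suc n}" by auto
  ultimately show ?case using attach.hyps(2) by (elim disjE) (auto simp del: atLeastatMost_subset_iff)
qed auto

lemma neighbours_subset: "friend_tree n E \<Longrightarrow> neighbours E v \<subseteq> {1..n}"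
proof
  fix w assume "friend_tree n E" "w \<in> neighbours E v"
  then show "w \<in> {1..n}" using edge_subset[of n E "{v, w}"] by (simp add: neighbours_def)
qed

lemma finite_neighbours: "friend_tree n E \<Longrightarrow> finite (neighbours E v)"
  by (rule finite_subset[OF neighbours_subset]) auto

lemma neighbours_outside: "friend_tree n E \<Longrightarrow> v \<notin> {1..n} \<Longrightarrow> neighbours E v = {}"
proof -
  assume "friend_tree n E" "v \<notin> {1..n}"
  then have "w \<notin> neighbours E v" for w
    using neighbours_subset[of n E w] neighbours_sym[of w E v] by auto
  then show ?thesis by blast
qed

lemma neighbours_edge: "neighbours {{1, 2}} v = (if v = 1 then {2} else if v = 2 then {1::nat} else {})"
  by (auto simp: neighbours_def doubleton_eq_iff)

lemma neighbours_attach: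
  assumes "friend_tree n E" "w \<in> {1..n}"
  shows "neighbours (insert {Suc n, w} E) v =
    (if v = Suc n then {w} else if v = w then insert (Suc n) (neighbours E w) else neighbours E v)"
proof -
  have "neighbours E (Suc n) = {}" "Suc n \<notin> neighbours E v"
    using neighbours_outside[OF assms(1)] neighbours_subset[OF assms(1), of v] by auto
  moreover have "neighbours (insert {Suc n, w} E) v
      = {u. v = Suc n \<and> u = w \<or> v = w \<and> u = Suc n} \<union> neighbours E v"
    by (auto simp: neighbours_def doubleton_eq_iff)
  ultimately show ?thesis using assms(2) by auto
qed

lemma deg_attach:
  assumes "friend_tree n E" "w \<in> {1..n}"
  shows "deg (insert {Suc n, w} E) v =
    (if v = Suc n then 1 else if v = w then Suc (deg E w) else deg E v)"
proof -
  have "Suc n \<notin> neighbours E w" using neighbours_subset[OF assms(1)] by fastforce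
  then show ?thesis
    using finite_neighbours[OF assms(1)] by (simp add: deg_def neighbours_attach[OF assms])
qed

lemma deg_pos: "friend_tree n E \<Longrightarrow> v \<in> {1..n} \<Longrightarrow> 0 < deg E v"
proof (induction rule: friend_tree.induct)
  case edge
  then show ?case by (auto simp: deg_def neighbours_edge simp del: One_nat_def)
next
  case (attach n E w)
  then show ?case by (auto simp: deg_attach)
qed

text \<open>When a vertex is added it has one edge, to an older vertex; all its later edges lead to younger
  vertices.\<close>

lemma card_smaller_neighbours: "friend_tree n E \<Longrightarrow> card {u \<in> neighbours E v. u < v} \<le> 1"
proof (induction rule: friend_tree.induct)
  case edge
  have "{u \<in> neighbours {{1, 2}} v. u < v} \<subseteq> {1}"
    by (auto simp: neighbours_edge simp del: One_nat_def split: if_splits)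
  from card_mono[OF _ this] show ?case by simp
next
  case (attach n E w)
  have "{u \<in> neighbours (insert {Suc n, w} E) v. u < v} \<subseteq>
     (if v = Suc n then {w} else {u \<in> neighbours E v. u < v})"
    using attach by (auto simp: neighbours_attach)
  moreover have "finite {u \<in> neighbours E v. u < v}"
    using finite_neighbours[OF attach(1)] by simp
  ultimately have "card {u \<in> neighbours (insert {Suc n, w} E) v. u < v} \<le>
     card (if v = Suc n then {w} else {u \<in> neighbours E v. u < v})"
    by (intro card_mono) auto
  also have "\<dots> \<le> 1" using attach.IH by simp
  finally show ?case .
qed

text \<open>Two adjacent leaves would be a whole connected component, but the tree is connected.\<close>

lemma leaf_neighbour_deg:
  assumes "friend_tree n E" "3 \<le> n" "deg E v = 1" "u \<in> neighbours E v"
  shows "2 \<le> deg E u"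
  using assms
proof (induction arbitrary: u v rule: friend_tree.induct)
  case edge
  then show ?case by simp
next
  case (attach n E w)
  note ft = attach(1,2)
  have w: "0 < deg E w" using deg_pos[OF ft] .
  show ?case
  proof (cases "v = Suc n \<or> u = w")
    case True
    then show ?thesis using w attach.prems
      using deg_attach[OF ft, of w] ft(2) by (auto simp: neighbours_attach[OF ft])
  next
    case False
    then have v: "v \<noteq> w" "deg E v = 1" "u \<in> neighbours E v"
      using attach.prems w by (auto simp: neighbours_attach[OF ft] deg_attach[OF ft] split: if_splits)
    show ?thesis
    proof (cases "n = 2")
      case True
      with ft(1) have "E = {{1,2}}"
        by (cases rule: friend_tree.cases) (auto dest: friend_tree_ge_2)
      with v True ft(2) False show ?thesis
        by (auto simp: neighbours_edge simp del: One_nat_def split: if_splits)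
    next
      case n: False
      then have "2 \<le> deg E u" using attach.IH[of v u] v friend_tree_ge_2[OF ft(1)] by simp
      moreover have "u \<noteq> Suc n" using v(3) neighbours_subset[OF ft(1), of v] by fastforce
      ultimately show ?thesis using False by (simp add: deg_attach[OF ft])
    qed
  qed
qed

lemma num_deg_ge_attach:
  assumes "friend_tree n E" "w \<in> {1..n}" "1 \<le> k"
  shows "num_deg_ge (Suc n) (insert {Suc n, w} E) (Suc k) = num_deg_ge n E (Suc k) + of_bool (deg E w = k)"
proof -
  have "{v \<in> {1..Suc n}. Suc k \<le> deg (insert {Suc n, w} E) v} =
     (if deg E w = k then insert w {v \<in> {1..n}. Suc k \<le> deg E v} else {v \<in> {1..n}. Suc k \<le> deg E v})"
    using assms(2,3) by (auto simp: deg_attach[OF assms(1,2)])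
  then show ?thesis by (simp add: num_deg_ge_def)
qed

text \<open>The conditional probability, given the tree \<open>E\<close> on \<open>{1..n}\<close>, that the next vertex is joined
  to \<open>w\<close>.\<close>

definition attach_prob :: "nat \<Rightarrow> nat set set \<Rightarrow> nat \<Rightarrow> real" where
  "attach_prob n E w = (\<Sum>v\<in>neighbours E w. 1 / real (deg E v)) / real n"

definition step_prob :: "nat \<Rightarrow> nat set set \<Rightarrow> (nat \<Rightarrow> bool) \<Rightarrow> real" where
  "step_prob n E A = (\<Sum>w\<in>{w\<in>{1..n}. A w}. attach_prob n E w)"

lemma one_div_nat_le_1: "1 / real d \<le> 1"
  by (cases d) auto

lemma step_prob_eq:
  "step_prob n E A = (\<Sum>w\<in>{w\<in>{1..n}. A w}. \<Sum>v\<in>neighbours E w. 1 / real (deg E v)) / n"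
  by (simp only: step_prob_def attach_prob_def sum_divide_distrib)

lemma attach_prob_nonneg: "0 \<le> attach_prob n E w"
  by (simp add: attach_prob_def sum_nonneg)

lemma step_prob_nonneg: "0 \<le> step_prob n E A"
  by (simp add: step_prob_def sum_nonneg attach_prob_nonneg)

text \<open>Double counting of pairs of adjacent vertices: each \<open>v\<close> hands out \<open>1 / deg v\<close> to each of its
  \<open>deg v\<close> neighbours.\<close>

lemma sum_attach_prob:
  assumes "friend_tree n E"
  shows "(\<Sum>w=1..n. attach_prob n E w) = 1"
proof -
  have nb: "neighbours E w = {v\<in>{1..n}. v \<in> neighbours E w}" for w
    using neighbours_subset[OF assms, of w] by blast
  have "(\<Sum>w=1..n. \<Sum>v\<in>neighbours E w. 1 / real (deg E v))
      = (\<Sum>w=1..n. \<Sum>v\<in>{v\<in>{1..n}. v \<in> neighbours E w}. 1 / real (deg E v))"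
    by (intro sum.cong refl nb)
  also have "\<dots> = (\<Sum>v=1..n. \<Sum>w\<in>{w\<in>{1..n}. v \<in> neighbours E w}. 1 / real (deg E v))"
    by (rule sum.swap_restrict) auto
  also have "\<dots> = (\<Sum>v=1..n. \<Sum>w\<in>neighbours E v. 1 / real (deg E v))"
  proof (intro sum.cong refl)
    fix v
    show "{w\<in>{1..n}. v \<in> neighbours E w} = neighbours E v"
      using nb[of v] neighbours_sym[of v E] by simp
  qed
  also have "\<dots> = (\<Sum>v=1..n. 1)"
    using deg_pos[OF assms] by (intro sum.cong) (auto simp: deg_def[symmetric])
  finally show ?thesis
    using friend_tree_ge_2[OF assms] by (simp add: attach_prob_def sum_divide_distrib[symmetric])
qed

text \<open>A vertex of degree \<open>k\<close> with a leaf neighbour \<open>v\<close> receives the next vertex with probability at least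
  \<open>1 / n\<close>, because choosing \<open>v\<close> forces it. Without a leaf neighbour there is no such bound: all
  neighbours may have huge degree.\<close>

definition good :: "nat \<Rightarrow> nat set set \<Rightarrow> nat \<Rightarrow> nat set" where
  "good n E k = {u\<in>{1..n}. deg E u = k \<and> (\<exists>v\<in>neighbours E u. deg E v = 1)}"

definition bad :: "nat \<Rightarrow> nat set set \<Rightarrow> nat \<Rightarrow> nat set" where
  "bad n E k = {u\<in>{1..n}. deg E u = k \<and> (\<forall>v\<in>neighbours E u. deg E v \<noteq> 1)}"

text \<open>Attaching a vertex to \<open>w\<close> turns the good vertex \<open>u\<close> into a bad one: \<open>w\<close> is its only leaf neighbour
  and ceases to be a leaf.\<close>

definition spoils :: "nat set set \<Rightarrow> nat \<Rightarrow> nat \<Rightarrow> bool" where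
  "spoils E k w \<longleftrightarrow> (\<exists>u. neighbours E w = {u} \<and> deg E u = k \<and> {v\<in>neighbours E u. deg E v = 1} = {w})"

lemma num_deg_ge_split:
  "num_deg_ge n E k = card (good n E k) + card (bad n E k) + num_deg_ge n E (Suc k)"
proof -
  have "{v\<in>{1..n}. k \<le> deg E v} = (good n E k \<union> bad n E k) \<union> {v\<in>{1..n}. Suc k \<le> deg E v}"
    by (auto simp: good_def bad_def)
  moreover have "card \<dots> = card (good n E k \<union> bad n E k) + card {v\<in>{1..n}. Suc k \<le> deg E v}"
    by (rule card_Un_disjoint) (auto simp: good_def bad_def)
  moreover have "card (good n E k \<union> bad n E k) = card (good n E k) + card (bad n E k)"
    by (rule card_Un_disjoint) (auto simp: good_def bad_def)
  ultimately show ?thesis by (simp add: num_deg_ge_def)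
qed

text \<open>Bad vertices are born only from good ones. A vertex that reaches degree \<open>k\<close> does so by receiving a
  leaf, hence it is good at that moment, and the new vertex itself has degree \<open>1 < k\<close>. A leaf
  has a single neighbour, so at most one vertex is spoilt per step.\<close>

lemma card_bad_attach:
  assumes ft: "friend_tree n E" "w \<in> {1..n}" and k: "2 \<le> k"
  shows "card (bad (Suc n) (insert {Suc n, w} E) k) \<le> card (bad n E k) + of_bool (spoils E k w)"
proof -
  let ?E = "insert {Suc n, w} E"
  note nb = neighbours_attach[OF ft] and dg = deg_attach[OF ft]
  have new: "u \<in> bad n E k \<or> (neighbours E w = {u} \<and> deg E u = k \<and> {v\<in>neighbours E u. deg E v = 1} = {w})"
    if u: "u \<in> bad (Suc n) ?E k" for u
  proof -
    have "u \<noteq> Suc n" using u k by (auto simp: bad_def dg)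
    moreover have "u \<noteq> w"
    proof
      assume "u = w"
      then have "Suc n \<in> neighbours ?E u" using ft(2) by (simp add: nb)
      moreover have "deg ?E (Suc n) = 1" by (simp add: dg)
      ultimately show False using u by (auto simp: bad_def)
    qed
    ultimately have u': "u \<in> {1..n}" "deg E u = k" "\<And>v. v \<in> neighbours E u \<Longrightarrow> deg ?E v \<noteq> 1"
      using u nb[of u] dg[of u] by (auto simp: bad_def)
    show ?thesis
    proof (cases "u \<in> bad n E k")
      case False
      with u' obtain v where v: "v \<in> neighbours E u" "deg E v = 1" by (auto simp: bad_def)
      have eq: "v' = w" if "v' \<in> neighbours E u" "deg E v' = 1" for v'
        using u'(3)[OF that(1)] that(2) by (simp add: dg split: if_splits)
      have "v = w" using eq v by blast
      then have "card (neighbours E w) = 1" "u \<in> neighbours E w"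
        using v neighbours_sym[of u E w] by (simp_all add: deg_def)
      then have "neighbours E w = {u}" by (metis card_1_singletonE singletonD)
      moreover have "{v\<in>neighbours E u. deg E v = 1} = {w}"
        using v \<open>v = w\<close> eq by blast
      ultimately show ?thesis using u'(2) by blast
    qed simp
  qed
  show ?thesis
  proof (cases "spoils E k w")
    case True
    then obtain u where "neighbours E w = {u}" by (auto simp: spoils_def)
    then have "bad (Suc n) ?E k \<subseteq> insert u (bad n E k)" using new by blast
    then have "card (bad (Suc n) ?E k) \<le> card (insert u (bad n E k))"
      by (rule card_mono[rotated]) (simp add: bad_def)
    also have "\<dots> \<le> card (bad n E k) + 1"
      by (simp add: card_insert_le_m1 bad_def card_insert_if)
    finally show ?thesis using True by simp
  next
    case False
    then have "bad (Suc n) ?E k \<subseteq> bad n E k" using new unfolding spoils_def by blast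
    then have "card (bad (Suc n) ?E k) \<le> card (bad n E k)"
      by (rule card_mono[rotated]) (simp add: bad_def)
    then show ?thesis by simp
  qed
qed

text \<open>The leaf neighbour alone contributes \<open>1 / n\<close> to the attachment probability of a good vertex.\<close>

lemma step_prob_deg_ge_good:
  assumes "friend_tree n E"
  shows "card (good n E k) / n \<le> step_prob n E (\<lambda>w. deg E w = k)"
proof -
  have "real (card (good n E k)) \<le> (\<Sum>w\<in>good n E k. \<Sum>v\<in>neighbours E w. 1 / real (deg E v))"
  proof -
    have "1 \<le> (\<Sum>v\<in>neighbours E w. 1 / real (deg E v))" if "w \<in> good n E k" for w
    proof -
      obtain v where v: "v \<in> neighbours E w" "deg E v = 1" using \<open>w \<in> good n E k\<close> by (auto simp: good_def)
      have "1 / real (deg E v) \<le> (\<Sum>v\<in>neighbours E w. 1 / real (deg E v))"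
        by (rule member_le_sum) (simp_all add: v(1) finite_neighbours[OF assms])
      with v(2) show ?thesis by simp
    qed
    then have "(\<Sum>w\<in>good n E k. 1) \<le> (\<Sum>w\<in>good n E k. \<Sum>v\<in>neighbours E w. 1 / real (deg E v))"
      by (rule sum_mono)
    then show ?thesis by simp
  qed
  also have "\<dots> \<le> (\<Sum>w\<in>{w\<in>{1..n}. deg E w = k}. \<Sum>v\<in>neighbours E w. 1 / real (deg E v))"
    by (rule sum_mono2) (auto simp: good_def sum_nonneg)
  finally show ?thesis
    unfolding step_prob_eq by (intro divide_right_mono) auto
qed

text \<open>A vertex that spoils is a leaf, so its attachment probability is \<open>1 / n\<close> divided by the degree of its
  only neighbour, and it is determined by the good vertex that it spoils. Together with the
  previous lemma this says that losing good vertices is at most as likely as promoting vertices of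
  degree \<open>k\<close> to degree \<open>k + 1\<close>.\<close>

lemma step_prob_spoils_le_good:
  assumes ft: "friend_tree n E"
  shows "step_prob n E (spoils E k) \<le> card (good n E k) / n"
proof -
  let ?S = "{w\<in>{1..n}. spoils E k w}"
  let ?f = "\<lambda>w. the_elem (neighbours E w)"
  have inj: "inj_on ?f ?S"
  proof (rule inj_onI)
    fix w w' assume "w \<in> ?S" "w' \<in> ?S" "?f w = ?f w'"
    then obtain u u' where "neighbours E w = {u}" "{v\<in>neighbours E u. deg E v = 1} = {w}"
      "neighbours E w' = {u'}" "{v\<in>neighbours E u'. deg E v = 1} = {w'}"
      unfolding spoils_def by blast
    moreover from this \<open>?f w = ?f w'\<close> have "u = u'" by simp
    ultimately show "w = w'" by blast
  qed
  have sub: "?f ` ?S \<subseteq> good n E k"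
  proof
    fix u assume "u \<in> ?f ` ?S"
    then obtain w where w: "neighbours E w = {u}" "deg E u = k" "{v\<in>neighbours E u. deg E v = 1} = {w}"
      by (auto simp: spoils_def)
    then have "u \<in> {1..n}" using neighbours_subset[OF ft, of w] by auto
    with w show "u \<in> good n E k" by (auto simp: good_def)
  qed
  have "(\<Sum>v\<in>neighbours E w. 1 / real (deg E v)) \<le> 1" if "w \<in> ?S" for w
    using that one_div_nat_le_1 by (auto simp: spoils_def)
  then have "(\<Sum>w\<in>?S. \<Sum>v\<in>neighbours E w. 1 / real (deg E v)) \<le> (\<Sum>w\<in>?S. 1)"
    by (rule sum_mono)
  also have "\<dots> = real (card ?S)" by simp
  also have "\<dots> \<le> card (good n E k)"
    using card_inj_on_le[OF inj sub] by (simp add: good_def)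
  finally show ?thesis
    unfolding step_prob_eq by (intro divide_right_mono) auto
qed

lemma step_prob_deg_le:
  assumes ft: "friend_tree n E"
  shows "step_prob n E (\<lambda>w. deg E w = k) \<le> real k * real (num_deg_ge n E k) / real n"
proof -
  let ?S = "{w\<in>{1..n}. deg E w = k}"
  have "(\<Sum>w\<in>?S. \<Sum>v\<in>neighbours E w. 1 / real (deg E v)) \<le> (\<Sum>w\<in>?S. real k)"
  proof (rule sum_mono)
    fix w assume w: "w \<in> ?S"
    have "(\<Sum>v\<in>neighbours E w. 1 / real (deg E v)) \<le> (\<Sum>v\<in>neighbours E w. 1)"
      by (rule sum_mono) (rule one_div_nat_le_1)
    with w show "(\<Sum>v\<in>neighbours E w. 1 / real (deg E v)) \<le> real k" by (simp add: deg_def)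
  qed
  also have "\<dots> = real k * card ?S" by simp
  also have "\<dots> \<le> real k * num_deg_ge n E k"
    unfolding num_deg_ge_def by (intro mult_left_mono) (auto intro!: card_mono)
  finally show ?thesis
    unfolding step_prob_eq by (intro divide_right_mono) auto
qed

text \<open>The neighbour of a leaf is not a leaf, so the sum over leaves can be regrouped by that neighbour:
  each vertex of degree at least \<open>2\<close> contributes the proportion of leaves among its neighbours.\<close>

lemma step_prob_leaf:
  assumes ft: "friend_tree n E" and n: "3 \<le> n"
  shows "step_prob n E (\<lambda>w. deg E w = 1)
    = (\<Sum>v\<in>{v\<in>{1..n}. 2 \<le> deg E v}. card {w\<in>neighbours E v. deg E w = 1} / deg E v) / n"
proof -
  let ?L = "{w\<in>{1..n}. deg E w = 1}" and ?N = "{v\<in>{1..n}. 2 \<le> deg E v}"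
  have *: "neighbours E w = {v\<in>?N. v \<in> neighbours E w}" if "w \<in> ?L" for w
    using that leaf_neighbour_deg[OF ft n, of w] neighbours_subset[OF ft, of w] by auto
  have "(\<Sum>w\<in>?L. \<Sum>v\<in>neighbours E w. 1 / real (deg E v))
      = (\<Sum>w\<in>?L. \<Sum>v\<in>{v\<in>?N. v \<in> neighbours E w}. 1 / real (deg E v))"
    using * by (intro sum.cong) auto
  also have "\<dots> = (\<Sum>v\<in>?N. \<Sum>w\<in>{w\<in>?L. v \<in> neighbours E w}. 1 / real (deg E v))"
    by (rule sum.swap_restrict) auto
  also have "\<dots> = (\<Sum>v\<in>?N. card {w\<in>neighbours E v. deg E w = 1} / deg E v)"
  proof (rule sum.cong)
    fix v
    have "{w\<in>?L. v \<in> neighbours E w} = {w\<in>neighbours E v. deg E w = 1}"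
      using neighbours_subset[OF ft, of v] neighbours_sym[of v E] by auto
    then show "(\<Sum>w\<in>{w\<in>?L. v \<in> neighbours E w}. 1 / real (deg E v))
        = card {w\<in>neighbours E v. deg E w = 1} / deg E v" by simp
  qed simp
  finally show ?thesis
    by (simp only: step_prob_eq)
qed

lemma step_prob_leaf_le:
  assumes ft: "friend_tree n E" and n: "3 \<le> n"
  shows "step_prob n E (\<lambda>w. deg E w = 1) \<le> num_deg_ge n E 2 / n"
proof -
  have "real (card {w\<in>neighbours E v. deg E w = 1}) / deg E v \<le> 1" for v
  proof -
    have "card {w\<in>neighbours E v. deg E w = 1} \<le> deg E v"
      unfolding deg_def[of E v] by (intro card_mono finite_neighbours[OF ft]) auto
    then show ?thesis by (cases "deg E v") auto
  qed
  from sum_mono[of "{v\<in>{1..n}. 2 \<le> deg E v}", OF this]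
  show ?thesis
    unfolding step_prob_leaf[OF assms] num_deg_ge_def by (intro divide_right_mono) auto
qed

lemma exists_inner_vertex: "friend_tree n E \<Longrightarrow> 3 \<le> n \<Longrightarrow> \<exists>v\<in>{1..n}. 2 \<le> deg E v"
  by (erule friend_tree.cases) (force simp: deg_attach dest: deg_pos)+

text \<open>Let \<open>v\<close> be the vertex with the largest label among those of degree at least \<open>2\<close>. Its younger
  neighbours are all leaves and it has at most one older neighbour, so at least half of its
  neighbours are leaves.\<close>

lemma step_prob_leaf_ge:
  assumes ft: "friend_tree n E" and n: "3 \<le> n"
  shows "1 / (2 * n) \<le> step_prob n E (\<lambda>w. deg E w = 1)"
proof -
  let ?N = "{v\<in>{1..n}. 2 \<le> deg E v}"
  define v where "v = Max ?N"
  have "?N \<noteq> {}" using exists_inner_vertex[OF assms] by blast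
  then have v: "v \<in> ?N" unfolding v_def by (intro Max_in) auto
  have max: "u \<le> v" if "u \<in> ?N" for u unfolding v_def using that by (intro Max_ge) auto
  let ?L = "{w\<in>neighbours E v. deg E w = 1}" and ?P = "{u\<in>neighbours E v. u < v}"
  have "neighbours E v \<subseteq> ?L \<union> ?P"
  proof
    fix u assume u: "u \<in> neighbours E v"
    then have "u \<in> {1..n}" using neighbours_subset[OF ft] by blast
    moreover have "u \<noteq> v"
    proof
      assume "u = v"
      then have "{v} \<in> E" using u by (simp add: neighbours_def)
      moreover have "{x} \<notin> E" for x
        using ft by (induction rule: friend_tree.induct) auto
      ultimately show False by blast
    qed
    \<comment> \<open>A neighbour of degree at least \<open>2\<close> has a smaller label than \<open>v\<close>; any other is a leaf.\<close>
    ultimately show "u \<in> ?L \<union> ?P"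
      using max[of u] u deg_pos[OF ft, of u] by (cases "2 \<le> deg E u") auto
  qed
  then have "deg E v \<le> card (?L \<union> ?P)"
    unfolding deg_def using finite_neighbours[OF ft] by (intro card_mono) auto
  also have "\<dots> \<le> card ?L + card ?P" by (rule card_Un_le)
  also have "\<dots> \<le> card ?L + 1" using card_smaller_neighbours[OF ft, of v] by simp
  finally have "deg E v \<le> card ?L + 1" .
  with v have "1 / 2 \<le> card ?L / deg E v" by (simp add: field_simps)
  also have "\<dots> \<le> (\<Sum>v\<in>?N. card {w\<in>neighbours E v. deg E w = 1} / deg E v)"
    using v by (intro member_le_sum) auto
  finally show ?thesis
    unfolding step_prob_leaf[OF assms] using n by (simp add: field_simps)
qed

lemma num_deg_ge_edge: "1 \<le> k \<Longrightarrow> num_deg_ge 2 {{1, 2}} (Suc k) = 0"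
proof -
  assume "1 \<le> k"
  then have "{v \<in> {1..2::nat}. Suc k \<le> deg {{1, 2}} v} = {}"
    by (auto simp: deg_def neighbours_edge simp del: One_nat_def)
  then show ?thesis unfolding num_deg_ge_def by (simp only: card.empty)
qed

lemma num_deg_ge_mono: "num_deg_ge n E (Suc k) \<le> num_deg_ge n E k"
  unfolding num_deg_ge_def by (intro card_mono) auto

section \<open>The law of the history\<close>

text \<open>A history is the list of the vertices \<open>W 2, W 3, ...\<close> chosen so far, the latest first; such lists
  form a countable type and determine the tree. A history of length \<open>n\<close> belongs to the tree on
  \<open>n + 2\<close> vertices.\<close>

primrec tree_of :: "nat list \<Rightarrow> nat set set" where
  "tree_of [] = {{1, 2}}"
| "tree_of (w # l) = insert {Suc (length l + 2), w} (tree_of l)"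

primrec legal :: "nat list \<Rightarrow> bool" where
  "legal [] \<longleftrightarrow> True"
| "legal (w # l) \<longleftrightarrow> w \<in> {1..length l + 2} \<and> legal l"

lemma friend_tree_tree_of: "legal l \<Longrightarrow> friend_tree (length l + 2) (tree_of l)"
proof (induction l)
  case Nil
  show ?case using friend_tree.edge by (simp add: numeral_2_eq_2)
next
  case (Cons w l)
  then have "friend_tree (Suc (length l + 2)) (insert {Suc (length l + 2), w} (tree_of l))"
    by (intro friend_tree.attach) simp_all
  then show ?case by (simp del: One_nat_def)
qed

context random_friend_tree
begin

primrec hist :: "nat \<Rightarrow> 'a \<Rightarrow> nat list" where
  "hist 0 \<omega> = []"
| "hist (Suc n) \<omega> = W (n + 2) \<omega> # hist n \<omega>"

lemma length_hist [simp]: "length (hist n \<omega>) = n"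
  by (induction n) auto

lemma T_hist: "\<omega> \<in> space M \<Longrightarrow> T (n + 2) \<omega> = tree_of (hist n \<omega>)"
proof (induction n)
  case 0
  then show ?case using T_2[of \<omega>] by (simp add: numeral_2_eq_2)
next
  case (Suc n)
  then show ?case using T_Suc[of "n + 2" \<omega>] by simp
qed

lemma hist_measurable [measurable]: "hist n \<in> measurable M (count_space UNIV)"
proof (induction n)
  case (Suc n)
  note [measurable] = Suc W_measurable
  have "(\<lambda>\<omega>. (\<lambda>w \<omega>. w # hist n \<omega>) (W (n + 2) \<omega>) \<omega>) \<in> measurable M (count_space UNIV)"
    by (rule measurable_compose_countable) measurable
  then show ?case by simp
qed simp

lemma hist_eqD: "hist n \<omega> = hist n \<omega>' \<Longrightarrow> j \<le> n \<Longrightarrow> hist j \<omega> = hist j \<omega>'"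
  by (induction n) (auto simp: le_Suc_eq)

text \<open>The locale conditions on the past of the trees, whereas the processes are functions of the
  vertices chosen. For legal histories the two carry the same information: the edge added at each
  step is not among the earlier edges, so it reveals the chosen vertex.\<close>

lemma hist_eq_iff:
  assumes "\<omega> \<in> space M" "\<omega>' \<in> space M" "legal (hist n \<omega>')"
  shows "hist n \<omega> = hist n \<omega>' \<longleftrightarrow> (\<forall>i\<in>{2..n+2}. T i \<omega> = T i \<omega>')"
proof
  assume eq: "hist n \<omega> = hist n \<omega>'"
  show "\<forall>i\<in>{2..n+2}. T i \<omega> = T i \<omega>'"
  proof
    fix i assume "i \<in> {2..n+2}"
    then obtain j where j: "i = j + 2" "j \<le> n"
      by (metis add_le_cancel_right atLeastAtMost_iff le_add_diff_inverse2)
    then show "T i \<omega> = T i \<omega>'"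
      using hist_eqD[OF eq j(2)] T_hist[OF assms(1), of j] T_hist[OF assms(2), of j] by simp
  qed
next
  show "\<forall>i\<in>{2..n+2}. T i \<omega> = T i \<omega>' \<Longrightarrow> hist n \<omega> = hist n \<omega>'"
    using assms(3)
  proof (induction n)
    case (Suc n)
    then have h: "hist n \<omega> = hist n \<omega>'" and l: "legal (hist n \<omega>')" by auto
    have "{Suc (n + 2), W (n + 2) \<omega>'} \<in> T (Suc (n + 2)) \<omega>'"
      using T_Suc[of "n + 2" \<omega>'] assms(2) by simp
    also have "\<dots> = T (Suc (n + 2)) \<omega>" using Suc.prems(1) by simp
    also have "\<dots> = insert {Suc (n + 2), W (n + 2) \<omega>} (tree_of (hist n \<omega>'))"
      using T_Suc[of "n + 2" \<omega>] T_hist[of \<omega> n] assms(1) h by simp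
    finally have "{Suc (n + 2), W (n + 2) \<omega>'} = {Suc (n + 2), W (n + 2) \<omega>}"
      using edge_subset[OF friend_tree_tree_of[OF l], of "{Suc (n + 2), W (n + 2) \<omega>'}"] by auto
    then have "W (n + 2) \<omega>' = W (n + 2) \<omega>" by (auto simp: doubleton_eq_iff)
    with h show ?case by simp
  qed simp
qed

text \<open>The law of total probability over the value \<open>v\<close> of \<open>V\<close>. Restricting to neighbours \<open>v\<close> of \<open>w\<close> only
  yields lower bounds, but the lower bounds for \<open>X\<close> and for its complement already add up to the
  probability of the conditioning event, so both are equalities.\<close>

lemma attach_law:
  assumes l: "legal l" and pos: "0 < prob {\<omega>\<in>space M. hist n \<omega> = l}"
  shows "prob {\<omega>\<in>space M. hist n \<omega> = l \<and> W (n + 2) \<omega> \<in> X}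
    = (\<Sum>w\<in>{w\<in>{1..n+2}. w \<in> X}. attach_prob (n + 2) (tree_of l) w) * prob {\<omega>\<in>space M. hist n \<omega> = l}"
proof -
  let ?m = "n + 2"
  define F where "F = {\<omega>\<in>space M. hist n \<omega> = l}"
  have [measurable]: "V ?m \<in> measurable M (count_space UNIV)" "W ?m \<in> measurable M (count_space UNIV)"
    by (auto intro: V_measurable W_measurable)
  have F [measurable]: "F \<in> sets M" unfolding F_def by measurable
  have sets_W: "{\<omega>\<in>F. W ?m \<omega> \<in> Y} \<in> sets M" for Y by measurable
  have "F \<noteq> {}" using pos unfolding F_def[symmetric] by auto
  then obtain \<omega>' where \<omega>': "\<omega>' \<in> space M" "hist n \<omega>' = l" by (auto simp: F_def)
  define t where "t i = T i \<omega>'" for i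
  have t: "t ?m = tree_of l" using T_hist[OF \<omega>'(1), of n] \<omega>'(2) by (simp add: t_def)
  have len: "length l = n" using \<omega>'(2) length_hist by blast
  have ft: "friend_tree ?m (tree_of l)" using friend_tree_tree_of[OF l] len by simp
  have past: "(\<forall>i\<in>{2..?m}. T i \<omega> = t i) \<longleftrightarrow> hist n \<omega> = l" if "\<omega> \<in> space M" for \<omega>
    using hist_eq_iff[OF that \<omega>'(1), of n] l \<omega>'(2) by (simp add: t_def)
  have pF: "\<P>(\<omega> in M. \<forall>i\<in>{2..?m}. T i \<omega> = t i) = prob F"
    unfolding F_def by (intro arg_cong[where f = prob]) (use past in blast)
  have VF: "prob {\<omega>\<in>F. V ?m \<omega> = v} = prob F / ?m" if v: "v \<in> {1..?m}" for v
  proof -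
    have "{\<omega>\<in>space M. V ?m \<omega> = v \<and> (\<forall>i\<in>{2..?m}. T i \<omega> = t i)} = {\<omega>\<in>F. V ?m \<omega> = v}"
      unfolding F_def using past by blast
    then show ?thesis
      using V_uniform[of ?m v t] v pF pos by (simp add: cond_prob_def F_def[symmetric] field_simps)
  qed
  have WF: "prob {\<omega>\<in>F. V ?m \<omega> = v \<and> W ?m \<omega> = w} = prob F / ?m / deg (tree_of l) v"
    if v: "v \<in> {1..?m}" and w: "w \<in> neighbours (tree_of l) v" for v w
  proof -
    have 1: "{\<omega>\<in>space M. (\<forall>i\<in>{2..?m}. T i \<omega> = t i) \<and> V ?m \<omega> = v} = {\<omega>\<in>F. V ?m \<omega> = v}"
      unfolding F_def using past by blast
    have 2: "{\<omega>\<in>space M. W ?m \<omega> = w \<and> (\<forall>i\<in>{2..?m}. T i \<omega> = t i) \<and> V ?m \<omega> = v}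
        = {\<omega>\<in>F. V ?m \<omega> = v \<and> W ?m \<omega> = w}"
      unfolding F_def using past by blast
    have p: "0 < prob {\<omega>\<in>F. V ?m \<omega> = v}" using VF[OF v] pos by (simp add: F_def)
    have "prob {\<omega>\<in>F. V ?m \<omega> = v \<and> W ?m \<omega> = w} / prob {\<omega>\<in>F. V ?m \<omega> = v} = 1 / deg (tree_of l) v"
      using W_uniform[of ?m v w t] v w p unfolding cond_prob_def 1 2 t by simp
    then have "prob {\<omega>\<in>F. V ?m \<omega> = v \<and> W ?m \<omega> = w} = prob {\<omega>\<in>F. V ?m \<omega> = v} / deg (tree_of l) v"
      using p by (simp add: divide_eq_eq)
    then show ?thesis unfolding VF[OF v] .
  qed
  \<comment> \<open>Disjoint events over pairs of a vertex \<open>w\<close> and a neighbour \<open>v\<close>.\<close>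
  have lower: "(\<Sum>w\<in>{w\<in>{1..?m}. w \<in> Y}. attach_prob ?m (tree_of l) w) * prob F
      \<le> prob {\<omega>\<in>F. W ?m \<omega> \<in> Y}" for Y
  proof -
    let ?Y = "{w\<in>{1..?m}. w \<in> Y}" and ?P = "\<lambda>w. neighbours (tree_of l) w"
    have sets_VW: "{\<omega>\<in>F. V ?m \<omega> = v \<and> W ?m \<omega> = w} \<in> sets M" for v w by measurable
    have fin: "finite (?P w)" for w by (rule finite_neighbours[OF ft])
    have "(\<Sum>w\<in>?Y. attach_prob ?m (tree_of l) w) * prob F
        = (\<Sum>w\<in>?Y. \<Sum>v\<in>?P w. prob {\<omega>\<in>F. V ?m \<omega> = v \<and> W ?m \<omega> = w})"
      unfolding sum_distrib_right attach_prob_def sum_divide_distrib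
    proof (intro sum.cong refl)
      fix w v assume "v \<in> ?P w"
      then have "v \<in> {1..?m}" "w \<in> ?P v"
        using neighbours_subset[OF ft, of w] neighbours_sym[of v "tree_of l" w] by auto
      from WF[OF this]
      show "1 / real (deg (tree_of l) v) / real ?m * prob F = prob {\<omega>\<in>F. V ?m \<omega> = v \<and> W ?m \<omega> = w}"
        by (simp add: field_simps)
    qed
    also have "\<dots> = (\<Sum>(w, v)\<in>Sigma ?Y ?P. prob {\<omega>\<in>F. V ?m \<omega> = v \<and> W ?m \<omega> = w})"
      by (rule sum.Sigma) (use fin in auto)
    also have "\<dots> = prob (\<Union>(w, v)\<in>Sigma ?Y ?P. {\<omega>\<in>F. V ?m \<omega> = v \<and> W ?m \<omega> = w})"
      unfolding split_beta
      by (rule finite_measure_finite_Union[symmetric])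
        (use fin sets_VW in \<open>auto simp: disjoint_family_on_def\<close>)
    also have "\<dots> \<le> prob {\<omega>\<in>F. W ?m \<omega> \<in> Y}"
      by (rule finite_measure_mono[OF _ sets_W]) auto
    finally show ?thesis .
  qed
  have total: "(\<Sum>w\<in>{w\<in>{1..?m}. w \<in> X}. attach_prob ?m (tree_of l) w)
      + (\<Sum>w\<in>{w\<in>{1..?m}. w \<in> - X}. attach_prob ?m (tree_of l) w) = 1"
  proof -
    have "{1..?m} = {w\<in>{1..?m}. w \<in> X} \<union> {w\<in>{1..?m}. w \<in> - X}"
      "{w\<in>{1..?m}. w \<in> X} \<inter> {w\<in>{1..?m}. w \<in> - X} = {}"
      by blast+
    then show ?thesis
      using sum_attach_prob[OF ft] sum.union_disjoint[of "{w\<in>{1..?m}. w \<in> X}" "{w\<in>{1..?m}. w \<in> - X}"]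
      by (metis (no_types, lifting) finite_atLeastAtMost finite_Un)
  qed
  have "prob {\<omega>\<in>F. W ?m \<omega> \<in> X} + prob {\<omega>\<in>F. W ?m \<omega> \<in> - X} = prob ({\<omega>\<in>F. W ?m \<omega> \<in> X} \<union> {\<omega>\<in>F. W ?m \<omega> \<in> - X})"
    by (rule finite_measure_Union[symmetric, OF sets_W sets_W]) auto
  also have "\<dots> = prob F" by (intro arg_cong[where f = prob]) auto
  finally have "prob {\<omega>\<in>F. W ?m \<omega> \<in> X}
      = (\<Sum>w\<in>{w\<in>{1..?m}. w \<in> X}. attach_prob ?m (tree_of l) w) * prob F"
    using lower[of X] lower[of "- X"] arg_cong[OF total, of "\<lambda>x. x * prob F"]
    unfolding distrib_right by linarith
  moreover have "{\<omega>\<in>F. W ?m \<omega> \<in> X} = {\<omega>\<in>space M. hist n \<omega> = l \<and> W ?m \<omega> \<in> X}"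
    by (auto simp: F_def)
  ultimately show ?thesis by (simp add: F_def)
qed

lemma AE_legal_hist: "AE \<omega> in M. legal (hist n \<omega>)"
proof (induction n)
  case (Suc n)
  have [measurable]: "W (n + 2) \<in> measurable M (count_space UNIV)" by (auto intro: W_measurable)
  have "AE \<omega> in M. legal l \<longrightarrow> hist n \<omega> = l \<longrightarrow> W (n + 2) \<omega> \<in> {1..n+2}" for l
  proof (cases "legal l")
    case True
    let ?B = "{\<omega>\<in>space M. hist n \<omega> = l \<and> W (n + 2) \<omega> \<in> - {1..n+2}}"
    have "W (n + 2) -` (- {1..n+2}) \<inter> space M \<in> sets M"
      by (rule measurable_sets[OF W_measurable]) simp_all
    moreover have "{\<omega>\<in>space M. hist n \<omega> = l} \<in> sets M" by measurable
    moreover have "?B = {\<omega>\<in>space M. hist n \<omega> = l} \<inter> (W (n + 2) -` (- {1..n+2}) \<inter> space M)"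
      by auto
    ultimately have B: "?B \<in> sets M" by (simp only: sets.Int)
    have "prob ?B = 0"
    proof (cases "0 < prob {\<omega>\<in>space M. hist n \<omega> = l}")
      case pos: True
      have "{w\<in>{1..n+2}. w \<in> - {1..n+2}} = {}" by auto
      then show ?thesis using attach_law[OF True pos, of "- {1..n+2}"] by (simp only: sum.empty mult_zero_left)
    next
      case False
      moreover have "prob ?B \<le> prob {\<omega>\<in>space M. hist n \<omega> = l}"
        by (rule finite_measure_mono) auto
      ultimately show ?thesis by (simp add: not_less measure_le_0_iff)
    qed
    then have "AE \<omega> in M. \<omega> \<notin> ?B" 
      using B by (intro AE_not_in null_setsI) (simp_all only: emeasure_eq_measure ennreal_0)
    then show ?thesis by (rule AE_mp) (auto intro!: AE_I2)
  qed simp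
  then have "AE \<omega> in M. \<forall>l. legal l \<longrightarrow> hist n \<omega> = l \<longrightarrow> W (n + 2) \<omega> \<in> {1..n+2}"
    unfolding AE_all_countable by blast
  with Suc show ?case by eventually_elim auto
qed simp

text \<open>On histories of positive probability this is the law of the attachment; on the others both sides
  vanish.\<close>

lemma step_law:
  "prob {\<omega>\<in>space M. hist n \<omega> = l \<and> A (tree_of (hist n \<omega>)) (W (n + 2) \<omega>)}
    = step_prob (n + 2) (tree_of l) (A (tree_of l)) * prob {\<omega>\<in>space M. hist n \<omega> = l}"
proof (cases "0 < prob {\<omega>\<in>space M. hist n \<omega> = l}")
  case True
  have "legal l"
  proof (rule ccontr)
    assume "\<not> legal l"
    then have "AE \<omega> in M. hist n \<omega> \<noteq> l" using AE_legal_hist[of n] by (rule_tac AE_mp) auto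
    then have "prob {\<omega>\<in>space M. hist n \<omega> = l} = 0" by (subst prob_Collect_eq_0) auto
    with True show False by simp
  qed
  have "{\<omega>\<in>space M. hist n \<omega> = l \<and> A (tree_of (hist n \<omega>)) (W (n + 2) \<omega>)}
      = {\<omega>\<in>space M. hist n \<omega> = l \<and> W (n + 2) \<omega> \<in> {w. A (tree_of l) w}}" by auto
  with attach_law[OF \<open>legal l\<close> True, of "{w. A (tree_of l) w}"] show ?thesis
    by (simp add: step_prob_def)
next
  case False
  have [measurable]: "W (n + 2) \<in> measurable M (count_space UNIV)" by (auto intro: W_measurable)
  have "prob {\<omega>\<in>space M. hist n \<omega> = l \<and> A (tree_of (hist n \<omega>)) (W (n + 2) \<omega>)}
      \<le> prob {\<omega>\<in>space M. hist n \<omega> = l}"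
    by (rule finite_measure_mono) auto
  with False show ?thesis by (simp add: not_less measure_le_0_iff)
qed

lemma AE_friend_tree: "AE \<omega> in M. \<forall>n\<ge>2. friend_tree n (T n \<omega>) \<and> W n \<omega> \<in> {1..n}"
proof -
  have "AE \<omega> in M. \<forall>n. legal (hist n \<omega>)" by (simp add: AE_all_countable AE_legal_hist)
  then show ?thesis
  proof (rule AE_mp, intro AE_I2 impI allI)
    fix \<omega> and n :: nat assume \<omega>: "\<omega> \<in> space M" "\<forall>n. legal (hist n \<omega>)" and "2 \<le> n"
    define m where "m = n - 2"
    have n: "n = m + 2" using \<open>2 \<le> n\<close> by (simp add: m_def)
    show "friend_tree n (T n \<omega>) \<and> W n \<omega> \<in> {1..n}"
      using friend_tree_tree_of[of "hist m \<omega>"] \<omega>(2)[rule_format, of m] \<omega>(2)[rule_format, of "Suc m"]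
        T_hist[OF \<omega>(1), of m] by (simp add: n)
  qed
qed

end

section \<open>Occurrences of events along the process\<close>

context random_friend_tree
begin

definition occurrences :: "(nat set set \<Rightarrow> nat \<Rightarrow> bool) \<Rightarrow> 'a \<Rightarrow> nat \<Rightarrow> real" where
  "occurrences A \<omega> n = (\<Sum>i\<in>{2..<n}. of_bool (A (T i \<omega>) (W i \<omega>)))"

definition compensator :: "(nat set set \<Rightarrow> nat \<Rightarrow> bool) \<Rightarrow> 'a \<Rightarrow> nat \<Rightarrow> real" where
  "compensator A \<omega> n = (\<Sum>i\<in>{2..<n}. step_prob i (T i \<omega>) (A (T i \<omega>)))"

lemma occurrences_Suc: "2 \<le> n \<Longrightarrow> occurrences A \<omega> (Suc n) = occurrences A \<omega> n + of_bool (A (T n \<omega>) (W n \<omega>))"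
  and compensator_Suc:
    "2 \<le> n \<Longrightarrow> compensator A \<omega> (Suc n) = compensator A \<omega> n + step_prob n (T n \<omega>) (A (T n \<omega>))"
  by (simp_all add: occurrences_def compensator_def)

lemma AE_occurrences_comparable:
  "AE \<omega> in M. \<exists>K. \<forall>n\<ge>2. occurrences A \<omega> n \<le> 2 * compensator A \<omega> n + K \<and> compensator A \<omega> n \<le> 2 * occurrences A \<omega> n + K"
proof -
  let ?A = "\<lambda>l. case l of [] \<Rightarrow> False | w # l' \<Rightarrow> A (tree_of l') w"
  let ?p = "\<lambda>n l. step_prob (n + 2) (tree_of l) (A (tree_of l))"
  have "AE \<omega> in M. \<exists>K. \<forall>n.
      (\<Sum>i<n. of_bool (?A (hist (Suc i) \<omega>))) \<le> 2 * (\<Sum>i<n. ?p i (hist i \<omega>)) + K \<and>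
      (\<Sum>i<n. ?p i (hist i \<omega>)) \<le> 2 * (\<Sum>i<n. of_bool (?A (hist (Suc i) \<omega>))) + K"
  proof (rule count_comparable_to_compensator[where past = tl])
    show "prob {\<omega>\<in>space M. hist n \<omega> = g \<and> ?A (hist (Suc n) \<omega>)} = ?p n g * prob {\<omega>\<in>space M. hist n \<omega> = g}"
      for n g using step_law[of n g A] by simp
  qed (auto simp: step_prob_nonneg)
  then show ?thesis
  proof (rule AE_mp, intro AE_I2 impI)
    fix \<omega> assume \<omega>: "\<omega> \<in> space M"
    have e: "occurrences A \<omega> (n + 2) = (\<Sum>i<n. of_bool (?A (hist (Suc i) \<omega>)))"
      and c: "compensator A \<omega> (n + 2) = (\<Sum>i<n. ?p i (hist i \<omega>))" for n
      using T_hist[OF \<omega>] by (induction n) (simp_all add: occurrences_def compensator_def)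
    assume "\<exists>K. \<forall>n.
      (\<Sum>i<n. of_bool (?A (hist (Suc i) \<omega>))) \<le> 2 * (\<Sum>i<n. ?p i (hist i \<omega>)) + K \<and>
      (\<Sum>i<n. ?p i (hist i \<omega>)) \<le> 2 * (\<Sum>i<n. of_bool (?A (hist (Suc i) \<omega>))) + K"
    then obtain K where K: "\<And>n. occurrences A \<omega> (n + 2) \<le> 2 * compensator A \<omega> (n + 2) + K
        \<and> compensator A \<omega> (n + 2) \<le> 2 * occurrences A \<omega> (n + 2) + K"
      unfolding e c by blast
    show "\<exists>K. \<forall>n\<ge>2. occurrences A \<omega> n \<le> 2 * compensator A \<omega> n + K \<and> compensator A \<omega> n \<le> 2 * occurrences A \<omega> n + K"
    proof (intro exI[of _ K] allI impI)
      fix n :: nat assume "2 \<le> n"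
      then obtain m where "n = m + 2" by (metis le_add_diff_inverse2)
      then show "occurrences A \<omega> n \<le> 2 * compensator A \<omega> n + K \<and> compensator A \<omega> n \<le> 2 * occurrences A \<omega> n + K"
        using K[of m] by simp
    qed
  qed
qed

lemma num_deg_ge_eq_occurrences:
  assumes \<omega>: "\<omega> \<in> space M" and ft: "\<forall>n\<ge>2. friend_tree n (T n \<omega>) \<and> W n \<omega> \<in> {1..n}"
    and k: "1 \<le> k" and n: "2 \<le> n"
  shows "real (num_deg_ge n (T n \<omega>) (Suc k)) = occurrences (\<lambda>E w. deg E w = k) \<omega> n"
  using n
proof (induction rule: dec_induct)
  case base
  show ?case using num_deg_ge_edge[OF k] T_2[OF \<omega>] by (simp add: occurrences_def)
next
  case (step n)
  then show ?case
    using num_deg_ge_attach[of n "T n \<omega>" "W n \<omega>" k] ft k T_Suc[of n \<omega>] \<omega>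
    by (simp add: occurrences_Suc)
qed

lemma card_bad_le_occurrences:
  assumes \<omega>: "\<omega> \<in> space M" and ft: "\<forall>n\<ge>2. friend_tree n (T n \<omega>) \<and> W n \<omega> \<in> {1..n}"
    and k: "2 \<le> k" and n: "2 \<le> n"
  shows "real (card (bad n (T n \<omega>) k)) \<le> occurrences (\<lambda>E. spoils E k) \<omega> n"
  using n
proof (induction rule: dec_induct)
  case base
  have "deg {{1, 2}} v \<noteq> k" for v :: nat using k by (simp add: deg_def neighbours_edge del: One_nat_def)
  then have "bad 2 {{1, 2}} k = {}" by (simp add: bad_def)
  then show ?case using T_2[OF \<omega>] by (simp add: occurrences_def)
next
  case (step n)
  have "real (card (bad (Suc n) (T (Suc n) \<omega>) k)) \<le> real (card (bad n (T n \<omega>) k) + of_bool (spoils (T n \<omega>) k (W n \<omega>)))"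
    using card_bad_attach[of n "T n \<omega>" "W n \<omega>" k] ft k T_Suc[of n \<omega>] \<omega> step.hyps by (intro of_nat_mono) simp
  then show ?case using step by (simp add: occurrences_Suc)
qed

lemma compensator_mono:
  assumes "\<And>n. 2 \<le> n \<Longrightarrow> step_prob n (T n \<omega>) (A (T n \<omega>)) \<le> step_prob n (T n \<omega>) (B (T n \<omega>))"
  shows "compensator A \<omega> n \<le> compensator B \<omega> n"
  unfolding compensator_def by (intro sum_mono) (use assms in auto)

end

section \<open>Induction on the degree\<close>

text \<open>For the number \<open>N\<close> of vertices of degree at least \<open>j + 2\<close>, \<open>growth_const j\<close> is a constant \<open>C\<close> such that
  \<open>N\<close> eventually grows with conditional probability at most \<open>C N / n\<close>. The ratio bound derived from it is
  \<open>c / 8\<close> for the largest \<open>c\<close> with \<open>c (20 + C) \<le> 1 / 2\<close>, that is, \<open>1 / (16 (20 + C))\<close>; dividing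
  \<open>j + 2\<close> by it gives the next growth constant.\<close>

primrec growth_const :: "nat \<Rightarrow> real" where
  "growth_const 0 = 1"
| "growth_const (Suc j) = (j + 2) * (16 * (20 + growth_const j))"

lemma growth_const_nonneg: "0 \<le> growth_const j"
  by (induction j) auto

definition ratio_const :: "nat \<Rightarrow> real" where
  "ratio_const j = 1 / (16 * (20 + growth_const j))"

lemma ratio_const_pos: "0 < ratio_const j"
  using growth_const_nonneg[of j] by (simp add: ratio_const_def)

context random_friend_tree
begin

text \<open>New vertices of degree at least \<open>2\<close> appear with probability at least \<open>1 / (2 n)\<close>, so the
  compensator grows at least like half the harmonic series.\<close>

lemma num_deg_ge_2_at_top:
  "AE \<omega> in M. filterlim (\<lambda>n. real (num_deg_ge n (T n \<omega>) 2)) at_top sequentially"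
  using AE_friend_tree AE_occurrences_comparable[of "\<lambda>E w. deg E w = 1"] AE_space
proof eventually_elim
  case (elim \<omega>)
  let ?S = "compensator (\<lambda>E w. deg E w = 1) \<omega>"
  obtain K where K: "\<And>n. 2 \<le> n \<Longrightarrow> ?S n \<le> 2 * occurrences (\<lambda>E w. deg E w = 1) \<omega> n + K"
    using elim(2) by blast
  have harm_le: "harm n \<le> 2 * ?S n + 3" if "3 \<le> n" for n
    using that
  proof (induction rule: dec_induct)
    case base
    have "0 \<le> ?S 3" by (simp add: compensator_def sum_nonneg step_prob_nonneg)
    then show ?case by (simp add: harm_expand)
  next
    case (step n)
    have "1 / (2 * real n) \<le> step_prob n (T n \<omega>) (\<lambda>w. deg (T n \<omega>) w = 1)"
      using step_prob_leaf_ge[of n "T n \<omega>"] elim(1) step.hyps by simp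
    moreover have "harm (Suc n) \<le> harm n + 2 * (1 / (2 * real n))"
      using step.hyps by (simp add: harm_Suc field_simps)
    ultimately show ?case using step by (simp add: compensator_Suc)
  qed
  have "eventually (\<lambda>n. (harm n - 3 - 2 * K) / 4 \<le> real (num_deg_ge n (T n \<omega>) 2)) sequentially"
    using eventually_ge_at_top[of 3]
  proof eventually_elim
    case (elim n)
    then show ?case
      using harm_le[of n] K[of n] num_deg_ge_eq_occurrences[OF \<open>\<omega> \<in> space M\<close> \<open>\<forall>n\<ge>2. friend_tree n (T n \<omega>) \<and> W n \<omega> \<in> {1..n}\<close>, of 1 n]
      by (simp add: numeral_2_eq_2)
  qed
  moreover have "filterlim (\<lambda>n. (harm n - 3 - 2 * K) / 4 :: real) at_top sequentially"
    by (rule filterlim_compose[OF _ harm_at_top]) real_asymp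
  ultimately show ?case by (rule filterlim_at_top_mono[rotated])
qed

text \<open>The comparison of growth rates, applied to the numbers \<open>x\<close> and \<open>y\<close> of vertices of degree at least \<open>j + 1\<close>
  and \<open>j + 2\<close>, with \<open>G\<close> the number of good vertices of degree \<open>j + 1\<close>. The essential inequality
  is \<open>x \<le> G + 5 y + K\<close>: the number of bad vertices is at most the number of spoiling events,
  which is controlled by its compensator, hence by the compensator of \<open>y\<close>, hence by \<open>4 y\<close>.\<close>

lemma ratio_eventually_ge:
  fixes c C :: real
  assumes j: "1 \<le> j" and c: "0 < c" "c * (20 + C) \<le> 1 / 2"
    and top: "AE \<omega> in M. filterlim (\<lambda>n. real (num_deg_ge n (T n \<omega>) (Suc j))) at_top sequentially"
    and rate: "AE \<omega> in M. eventually (\<lambda>n. step_prob n (T n \<omega>) (\<lambda>w. deg (T n \<omega>) w = j)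
      \<le> C * num_deg_ge n (T n \<omega>) (Suc j) / n) sequentially"
  shows "AE \<omega> in M. eventually (\<lambda>n. c / 8 * num_deg_ge n (T n \<omega>) (Suc j)
    \<le> num_deg_ge n (T n \<omega>) (Suc (Suc j))) sequentially"
  using top rate AE_friend_tree AE_space
    AE_occurrences_comparable[of "\<lambda>E w. deg E w = j"]
    AE_occurrences_comparable[of "\<lambda>E w. deg E w = Suc j"]
    AE_occurrences_comparable[of "\<lambda>E. spoils E (Suc j)"]
proof eventually_elim
  case (elim \<omega>)
  let ?x = "\<lambda>n. real (num_deg_ge n (T n \<omega>) (Suc j))"
  let ?y = "\<lambda>n. real (num_deg_ge n (T n \<omega>) (Suc (Suc j)))"
  let ?X = "compensator (\<lambda>E w. deg E w = j) \<omega>"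
  let ?Y = "compensator (\<lambda>E w. deg E w = Suc j) \<omega>"
  let ?B = "compensator (\<lambda>E. spoils E (Suc j)) \<omega>"
  let ?G = "\<lambda>n. real (card (good n (T n \<omega>) (Suc j)))"
  note ft = \<open>\<forall>n\<ge>2. friend_tree n (T n \<omega>) \<and> W n \<omega> \<in> {1..n}\<close>
  note x = num_deg_ge_eq_occurrences[OF \<open>\<omega> \<in> space M\<close> ft j]
  note y = num_deg_ge_eq_occurrences[OF \<open>\<omega> \<in> space M\<close> ft, of "Suc j"]
  obtain K1 where K1: "\<And>n. 2 \<le> n \<Longrightarrow> ?x n \<le> 2 * ?X n + K1 \<and> ?X n \<le> 2 * ?x n + K1"
    using elim(5) x by auto
  obtain K2 where K2: "\<And>n. 2 \<le> n \<Longrightarrow> ?y n \<le> 2 * ?Y n + K2 \<and> ?Y n \<le> 2 * ?y n + K2"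
    using elim(6) y by auto
  obtain K3 where K3: "\<And>n. 2 \<le> n \<Longrightarrow> occurrences (\<lambda>E. spoils E (Suc j)) \<omega> n \<le> 2 * ?B n + K3"
    using elim(7) by auto
  have BY: "?B n \<le> ?Y n" for n
    using step_prob_spoils_le_good step_prob_deg_ge_good ft by (intro compensator_mono) (meson order_trans)
  define K where "K = \<bar>K1\<bar> + 2 * \<bar>K2\<bar> + \<bar>K3\<bar>"
  show ?case
  proof (rule growth_comparison[where X = ?X and Y = ?Y and G = ?G and K = K and C = C])
    fix n :: nat assume n: "2 \<le> n"
    show "?X n \<le> 2 * ?x n + K \<and> ?y n \<le> 2 * ?Y n + K \<and> ?Y n \<le> 2 * ?y n + K \<and> ?x n \<le> 2 * ?X n + K"
      using K1[OF n] K2[OF n] unfolding K_def by linarith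
    have "?x n = ?G n + card (bad n (T n \<omega>) (Suc j)) + ?y n"
      by (subst num_deg_ge_split) simp
    moreover have "card (bad n (T n \<omega>) (Suc j)) \<le> occurrences (\<lambda>E. spoils E (Suc j)) \<omega> n"
      using card_bad_le_occurrences[OF \<open>\<omega> \<in> space M\<close> ft _ n] j by simp
    ultimately show "?x n \<le> ?G n + 5 * ?y n + K"
      using K3[OF n] BY[of n] K2[OF n] unfolding K_def by linarith
    show "?Y n + ?G n / n \<le> ?Y (Suc n)"
      using step_prob_deg_ge_good[of n "T n \<omega>" "Suc j"] ft n by (simp add: compensator_Suc)
  next
    show "eventually (\<lambda>n. ?X (Suc n) \<le> ?X n + C * ?x n / n) sequentially"
      using elim(2) eventually_ge_at_top[of 2] by eventually_elim (simp add: compensator_Suc)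
  qed (use elim(1) c in auto)
qed

lemma ratio_ge_ratio_const:
  assumes "AE \<omega> in M. filterlim (\<lambda>n. real (num_deg_ge n (T n \<omega>) (j + 2))) at_top sequentially"
    and "AE \<omega> in M. eventually (\<lambda>n. step_prob n (T n \<omega>) (\<lambda>w. deg (T n \<omega>) w = j + 1)
      \<le> growth_const j * num_deg_ge n (T n \<omega>) (j + 2) / n) sequentially"
  shows "AE \<omega> in M. eventually (\<lambda>n. ratio_const j * num_deg_ge n (T n \<omega>) (j + 2)
    \<le> num_deg_ge n (T n \<omega>) (j + 3)) sequentially"
proof -
  have c: "0 < 8 * ratio_const j" "8 * ratio_const j * (20 + growth_const j) \<le> 1 / 2"
    using growth_const_nonneg[of j] by (simp_all add: ratio_const_def)
  have "Suc (j + 1) = j + 2" "Suc (Suc (j + 1)) = j + 3" "8 * ratio_const j / 8 = ratio_const j" by simp_all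
  with ratio_eventually_ge[OF _ c, of "j + 1"] assms show ?thesis by (simp add: numeral_3_eq_3)
qed

text \<open>Induction on the degree. The bound on the growth rate for the next degree uses the crude rate
  \<open>(j + 2) x / n\<close> in terms of the number \<open>x\<close> of vertices of degree at least \<open>j + 2\<close>; the ratio bound just obtained
  turns \<open>x\<close> into a multiple of the number of vertices of degree at least \<open>j + 3\<close>.\<close>

lemma growth_rate:
  "(AE \<omega> in M. filterlim (\<lambda>n. real (num_deg_ge n (T n \<omega>) (j + 2))) at_top sequentially) \<and>
   (AE \<omega> in M. eventually (\<lambda>n. step_prob n (T n \<omega>) (\<lambda>w. deg (T n \<omega>) w = j + 1)
      \<le> growth_const j * num_deg_ge n (T n \<omega>) (j + 2) / n) sequentially)"
proof (induction j)
  case 0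
  have "AE \<omega> in M. eventually (\<lambda>n. step_prob n (T n \<omega>) (\<lambda>w. deg (T n \<omega>) w = 1)
      \<le> num_deg_ge n (T n \<omega>) 2 / n) sequentially"
    using AE_friend_tree
  proof eventually_elim
    case (elim \<omega>)
    show ?case
      using eventually_ge_at_top[of 3]
      by eventually_elim (use step_prob_leaf_le elim in auto)
  qed
  then show ?case using num_deg_ge_2_at_top by (simp add: numeral_2_eq_2)
next
  case (Suc j)
  then have ratio: "AE \<omega> in M. eventually (\<lambda>n. ratio_const j * num_deg_ge n (T n \<omega>) (j + 2)
    \<le> num_deg_ge n (T n \<omega>) (j + 3)) sequentially"
    using ratio_ge_ratio_const by blast
  have "AE \<omega> in M. filterlim (\<lambda>n. real (num_deg_ge n (T n \<omega>) (j + 3))) at_top sequentially"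
    using ratio Suc[THEN conjunct1]
  proof eventually_elim
    case (elim \<omega>)
    have "filterlim (\<lambda>n. ratio_const j * real (num_deg_ge n (T n \<omega>) (j + 2))) at_top sequentially"
      by (rule filterlim_tendsto_pos_mult_at_top[OF tendsto_const ratio_const_pos elim(2)])
    then show ?case using elim(1) by (rule filterlim_at_top_mono)
  qed
  moreover have "AE \<omega> in M. eventually (\<lambda>n. step_prob n (T n \<omega>) (\<lambda>w. deg (T n \<omega>) w = j + 2)
      \<le> growth_const (Suc j) * num_deg_ge n (T n \<omega>) (j + 3) / n) sequentially"
    using ratio AE_friend_tree
  proof eventually_elim
    case (elim \<omega>)
    show ?case
      using elim(1) eventually_ge_at_top[of 2]
    proof eventually_elim
      case (elim n)
      let ?x = "real (num_deg_ge n (T n \<omega>) (j + 2))" and ?y = "real (num_deg_ge n (T n \<omega>) (j + 3))"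
      have "friend_tree n (T n \<omega>)"
        using \<open>\<forall>n\<ge>2. friend_tree n (T n \<omega>) \<and> W n \<omega> \<in> {1..n}\<close> elim(2) by blast
      then have "step_prob n (T n \<omega>) (\<lambda>w. deg (T n \<omega>) w = j + 2) \<le> real (j + 2) * ?x / n"
        by (rule step_prob_deg_le)
      also have "?x \<le> 16 * (20 + growth_const j) * ?y"
        using elim(1) growth_const_nonneg[of j] by (simp add: ratio_const_def field_simps)
      then have "real (j + 2) * ?x / n \<le> real (j + 2) * (16 * (20 + growth_const j) * ?y) / n"
        by (intro divide_right_mono mult_left_mono) auto
      finally show ?case by (simp add: mult.assoc add.commute)
    qed
  qed
  ultimately show ?case by (simp add: eval_nat_numeral)
qed

text \<open>Halving the constant makes the lower bound strict. Almost surely the denominator is eventually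
  positive, so the restriction to such \<open>n\<close> does not change the filter.\<close>

lemma liminf_ratio_bounds:
  assumes "2 \<le> k"
  shows "AE \<omega> in M.
    (let L = Liminf (inf sequentially (principal {n. 0 < num_deg_ge n (T n \<omega>) k}))
               (\<lambda>n. ereal (real (num_deg_ge n (T n \<omega>) (k + 1)) / real (num_deg_ge n (T n \<omega>) k)))
     in ereal (ratio_const (k - 2) / 2) < L \<and> L \<le> 1)"
proof -
  obtain j where k: "k = j + 2" using assms by (metis le_add_diff_inverse2)
  show ?thesis
    using growth_rate[THEN conjunct1, of j]
      ratio_ge_ratio_const[OF growth_rate[THEN conjunct1] growth_rate[THEN conjunct2], of j]
  proof eventually_elim
    case (elim \<omega>)
    let ?x = "\<lambda>n. real (num_deg_ge n (T n \<omega>) k)" and ?y = "\<lambda>n. real (num_deg_ge n (T n \<omega>) (k + 1))"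
    let ?F = "inf sequentially (principal {n. 0 < num_deg_ge n (T n \<omega>) k})"
    have pos: "eventually (\<lambda>n. 0 < ?x n) sequentially"
      using elim(1) unfolding k filterlim_at_top_dense by blast
    then have F: "?F = sequentially"
      by (intro inf_absorb1) (simp add: le_principal)
    have "eventually (\<lambda>n. ereal (ratio_const j) \<le> ereal (?y n / ?x n)) sequentially"
      using pos elim(2)
    proof eventually_elim
      case (elim n)
      have "k + 1 = j + 3" by (simp add: k)
      with elim show ?case by (simp add: k numeral_3_eq_3 field_simps)
    qed
    then have "ereal (ratio_const j) \<le> Liminf ?F (\<lambda>n. ereal (?y n / ?x n))"
      unfolding F by (rule Liminf_bounded)
    moreover have "ereal (ratio_const (k - 2) / 2) < ereal (ratio_const j)"
      using ratio_const_pos[of j] by (simp add: k)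
    moreover have "Liminf ?F (\<lambda>n. ereal (?y n / ?x n)) \<le> 1"
      unfolding F
    proof (rule Liminf_le)
      show "eventually (\<lambda>n. ereal (?y n / ?x n) \<le> 1) sequentially"
        using pos by eventually_elim (use num_deg_ge_mono[of _ _ k] in \<open>simp add: divide_le_eq_1 one_ereal_def\<close>)
    qed simp
    ultimately show ?case unfolding Let_def by (blast intro: less_le_trans)
  qed
qed

end

theorem theorem4p8:
  "\<exists>c :: nat \<Rightarrow> real.
     (\<forall>k\<ge>2. 0 < c k) \<and>
     (\<forall>(M :: 'a measure) T V W. random_friend_tree M T V W \<longrightarrow>
       (\<forall>k\<ge>2. AE \<omega> in M.
          (let L = Liminf (inf sequentially (principal {n. 0 < num_deg_ge n (T n \<omega>) k}))
                     (\<lambda>n. ereal (real (num_deg_ge n (T n \<omega>) (k + 1)) /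
                                 real (num_deg_ge n (T n \<omega>) k)))
           in ereal (c k) < L \<and> L \<le> 1)))"
proof (intro exI[of _ "\<lambda>k. ratio_const (k - 2) / 2"] conjI allI impI)
  show "0 < ratio_const (k - 2) / 2" for k using ratio_const_pos by simp
qed (rule random_friend_tree.liminf_ratio_bounds)

end
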